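(* Let $(S,\mathcal{C})$ be a connected connectoid and let $U\subseteq S$. Then the following are equivalent: (1) for every $r\in S$ there is a normal tree of $(S,\mathcal{C})$ rooted at $r$ that contains $U$; (2) there is a weak normal tree of $(S,\mathcal{C})$ that contains $U$; (3) there is a rooted tree $T$ with $U\subseteq V(T)\subseteq S$ such that for every $C\in\mathcal{C}$ and every two $\leq_T$-incomparable elements $u,v\in C\cap V(T)$ there is $w\in C$ with $w\leq_T u$ and $w\leq_T v$; (4) $U$ is a countable union of dispersed sets; (5) $U$ is a countable union of fat $TK_{\aleph_0}$-dispersed sets.
   Context: Connectoids: let $S$ be a set and let $\mathcal{F}$ be a set of finite subsets of $S$ such that (i) $F\cup F'\in\mathcal{F}$ whenever $F,F'\in\mathcal{F}$ and $F\cap F'\neq\emptyset$, and (ii) $\emptyset\in\mathcal{F}$ and $\{s\}\in\mathcal{F}$ for every $s\in S$. A subset $C\subseteq S$ is connected if for every $x,y\in C$ there is $F\in\mathcal{F}$ with $F\subseteq C$ and $x,y\in F$. The pair $(S,\mathcal{C})$, where $\mathcal{C}$ is the set of connected subsets of $S$, is the connectoid induced by $\mathcal{F}$; a connectoid is any pair arising in this way. It is connected if $S\in\mathcal{C}$. Necklaces: with $\mathbb{N}=\{1,2,3,\dots\}$, a connected set $N$ is a necklace if there is a family $(H_n)_{n\in\mathbb{N}}$ of finite connected sets with $N=\bigcup_{n}H_n$ such that, for all $i,j\in\mathbb{N}$, $H_i\cap H_j\neq\emptyset$ if and only if $|i-j|\leq 1$. Normal trees: $\leq_T$ denotes the tree-order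 of a rooted tree $T$ (the root is the least element). A weak normal tree of $(S,\mathcal{C})$ is a rooted undirected tree $T$ with $V(T)\subseteq S$ such that (a) for every $C\in\mathcal{C}$ and every two $\leq_T$-incomparable $u,v\in C\cap V(T)$ there is $w\in C$ with $w\leq_T u,v$, and (b) for every $u\leq_T v$ in $V(T)$ there is $C\in\mathcal{C}$ with $u,v\in C$ that contains no $w<_T u$. (The edges of $T$ need have no relation to $\mathcal{C}$ beyond this.) A weak normal tree $T$ is a normal tree if moreover for every ray $R$ in $T$ starting at the root there is a necklace containing all but finitely many elements of $V(R)$. A tree contains $U$ if $U\subseteq V(T)$. Dispersedness: $W\subseteq S$ is dispersed if every necklace in $(S,\mathcal{C})$ has finite intersection with $W$. Fat $TK_{\aleph_0}$: for two disjoint finite sets $X,Y\subseteq S$, an $X$–$Y$ link is a finite connected set of the form $C_1\cup C_2$, where $C_1,C_2$ are connected sets with $X\subseteq C_1\setminus C_2$, $Y\subseteq C_2\setminus C_1$ and $C_1\cap C_2\neq\emptyset$. Two $X$–$Y$ links are internally disjoint if they intersect only in $X\cup Y$. A fat $TK_{\aleph_0}$ is a family $(B_n)_{n\in\mathbb{N}}$ of pairwise disjoint finite connected sets (its branch sets) together with, for every $n\neq m$, uncountably many pairwise internally disjoint $B_n$–$B_m$ links. A set $W\subseteq S$ is fat $TK_{\aleph_0}$-dispersed if for every fat $TK_{\aleph_0}$ at most finitely many of its branch sets contain an element of $W$. *)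

theory Defs
  imports "HOL-Library.Countable_Set"
begin

section \<open>Connectoids\<close>

definition generating_family :: "'a set \<Rightarrow> 'a set set \<Rightarrow> bool" where
  "generating_family S \<F> \<longleftrightarrow>
     (\<forall>F\<in>\<F>. finite F \<and> F \<subseteq> S) \<and>
     (\<forall>F\<in>\<F>. \<forall>F'\<in>\<F>. F \<inter> F' \<noteq> {} \<longrightarrow> F \<union> F' \<in> \<F>) \<and>
     {} \<in> \<F> \<and> (\<forall>s\<in>S. {s} \<in> \<F>)"

definition induced_connected_sets :: "'a set \<Rightarrow> 'a set set \<Rightarrow> 'a set set" where
  "induced_connected_sets S \<F> =
     {C. C \<subseteq> S \<and> (\<forall>x\<in>C. \<forall>y\<in>C. \<exists>F\<in>\<F>. F \<subseteq> C \<and> x \<in> F \<and> y \<in> F)}"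

definition connectoid :: "'a set \<Rightarrow> 'a set set \<Rightarrow> bool" where
  "connectoid S \<C> \<longleftrightarrow>
     (\<exists>\<F>. generating_family S \<F> \<and> \<C> = induced_connected_sets S \<F>)"

definition connected_connectoid :: "'a set \<Rightarrow> 'a set set \<Rightarrow> bool" where
  "connected_connectoid S \<C> \<longleftrightarrow> connectoid S \<C> \<and> S \<in> \<C>"

definition necklace :: "'a set set \<Rightarrow> 'a set \<Rightarrow> bool" where
  "necklace \<C> N \<longleftrightarrow> N \<in> \<C> \<and>
     (\<exists>H :: nat \<Rightarrow> 'a set.
        (\<forall>n. finite (H n) \<and> H n \<in> \<C>) \<and>
        N = (\<Union>n. H n) \<and>
        (\<forall>i j. H i \<inter> H j \<noteq> {} \<longleftrightarrow> \<bar>int i - int j\<bar> \<le> 1))"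

definition dispersed :: "'a set \<Rightarrow> 'a set set \<Rightarrow> 'a set \<Rightarrow> bool" where
  "dispersed S \<C> W \<longleftrightarrow> W \<subseteq> S \<and> (\<forall>N. necklace \<C> N \<longrightarrow> finite (N \<inter> W))"


section \<open>Rooted undirected trees\<close>

text \<open>Edges are two-element sets of vertices; trees may be infinite, and there is no empty rooted
  tree, since the root is a vertex.\<close>

record 'a rooted_graph =
  gverts :: "'a set"
  gedges :: "'a set set"
  groot :: 'a

definition adjacent :: "'a rooted_graph \<Rightarrow> 'a \<Rightarrow> 'a \<Rightarrow> bool" where
  "adjacent T u v \<longleftrightarrow> {u, v} \<in> gedges T"

definition graph_path :: "'a rooted_graph \<Rightarrow> 'a \<Rightarrow> 'a list \<Rightarrow> 'a \<Rightarrow> bool" where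
  "graph_path T u p v \<longleftrightarrow>
     p \<noteq> [] \<and> set p \<subseteq> gverts T \<and> distinct p \<and> successively (adjacent T) p \<and>
     hd p = u \<and> last p = v"

definition graph_cycle :: "'a rooted_graph \<Rightarrow> 'a list \<Rightarrow> bool" where
  "graph_cycle T p \<longleftrightarrow>
     length p \<ge> 3 \<and> distinct p \<and> successively (adjacent T) p \<and> adjacent T (last p) (hd p)"

definition rooted_tree :: "'a rooted_graph \<Rightarrow> bool" where
  "rooted_tree T \<longleftrightarrow>
     (\<forall>e\<in>gedges T. \<exists>u\<in>gverts T. \<exists>v\<in>gverts T. u \<noteq> v \<and> e = {u, v}) \<and>
     (\<forall>u\<in>gverts T. \<forall>v\<in>gverts T. \<exists>p. graph_path T u p v) \<and>
     (\<nexists>p. graph_cycle T p) \<and>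
     groot T \<in> gverts T"

text \<open>The tree-order: \<open>u\<close> lies on the (unique) path from the root to \<open>v\<close>. In particular, both
  \<open>u\<close> and \<open>v\<close> are vertices of the tree.\<close>

definition tree_le :: "'a rooted_graph \<Rightarrow> 'a \<Rightarrow> 'a \<Rightarrow> bool" where
  "tree_le T u v \<longleftrightarrow> (\<exists>p. graph_path T (groot T) p v \<and> u \<in> set p)"

definition tree_less :: "'a rooted_graph \<Rightarrow> 'a \<Rightarrow> 'a \<Rightarrow> bool" where
  "tree_less T u v \<longleftrightarrow> tree_le T u v \<and> u \<noteq> v"

definition tree_incomparable :: "'a rooted_graph \<Rightarrow> 'a \<Rightarrow> 'a \<Rightarrow> bool" where
  "tree_incomparable T u v \<longleftrightarrow> \<not> tree_le T u v \<and> \<not> tree_le T v u"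

definition rooted_ray :: "'a rooted_graph \<Rightarrow> (nat \<Rightarrow> 'a) \<Rightarrow> bool" where
  "rooted_ray T R \<longleftrightarrow> inj R \<and> R 0 = groot T \<and> (\<forall>n. adjacent T (R n) (R (Suc n)))"


section \<open>Normal trees\<close>

definition separates_incomparable :: "'a set set \<Rightarrow> 'a rooted_graph \<Rightarrow> bool" where
  "separates_incomparable \<C> T \<longleftrightarrow>
     (\<forall>C\<in>\<C>. \<forall>u \<in> C \<inter> gverts T. \<forall>v \<in> C \<inter> gverts T.
        tree_incomparable T u v \<longrightarrow> (\<exists>w\<in>C. tree_le T w u \<and> tree_le T w v))"

definition weak_normal_tree :: "'a set \<Rightarrow> 'a set set \<Rightarrow> 'a rooted_graph \<Rightarrow> bool" where
  "weak_normal_tree S \<C> T \<longleftrightarrow>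
     rooted_tree T \<and> gverts T \<subseteq> S \<and>
     separates_incomparable \<C> T \<and>
     (\<forall>u v. tree_le T u v \<longrightarrow>
        (\<exists>C\<in>\<C>. u \<in> C \<and> v \<in> C \<and> (\<forall>w\<in>C. \<not> tree_less T w u)))"

definition normal_tree :: "'a set \<Rightarrow> 'a set set \<Rightarrow> 'a rooted_graph \<Rightarrow> bool" where
  "normal_tree S \<C> T \<longleftrightarrow>
     weak_normal_tree S \<C> T \<and>
     (\<forall>R. rooted_ray T R \<longrightarrow> (\<exists>N. necklace \<C> N \<and> finite (range R - N)))"


section \<open>Fat $TK_{\aleph_0}$\<close>

definition XY_link :: "'a set set \<Rightarrow> 'a set \<Rightarrow> 'a set \<Rightarrow> 'a set \<Rightarrow> bool" where
  "XY_link \<C> X Y L \<longleftrightarrow>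
     finite L \<and> L \<in> \<C> \<and>
     (\<exists>C1\<in>\<C>. \<exists>C2\<in>\<C>. L = C1 \<union> C2 \<and>
        X \<subseteq> C1 - C2 \<and> Y \<subseteq> C2 - C1 \<and> C1 \<inter> C2 \<noteq> {})"

text \<open>\<open>B\<close> is the family of branch sets and \<open>\<L> n m\<close> the chosen uncountable set of links between
  \<open>B n\<close> and \<open>B m\<close>. Links between different pairs of branch sets may meet.\<close>

definition fat_TK :: "'a set set \<Rightarrow> (nat \<Rightarrow> 'a set) \<Rightarrow> (nat \<Rightarrow> nat \<Rightarrow> 'a set set) \<Rightarrow> bool" where
  "fat_TK \<C> B \<L> \<longleftrightarrow>
     (\<forall>n. finite (B n) \<and> B n \<in> \<C>) \<and>
     (\<forall>n m. n \<noteq> m \<longrightarrow> B n \<inter> B m = {}) \<and>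
     (\<forall>n m. n \<noteq> m \<longrightarrow>
        uncountable (\<L> n m) \<and>
        (\<forall>L \<in> \<L> n m. XY_link \<C> (B n) (B m) L) \<and>
        (\<forall>L \<in> \<L> n m. \<forall>L' \<in> \<L> n m. L \<noteq> L' \<longrightarrow> L \<inter> L' \<subseteq> B n \<union> B m))"

definition fat_TK_dispersed :: "'a set \<Rightarrow> 'a set set \<Rightarrow> 'a set \<Rightarrow> bool" where
  "fat_TK_dispersed S \<C> W \<longleftrightarrow>
     W \<subseteq> S \<and> (\<forall>B \<L>. fat_TK \<C> B \<L> \<longrightarrow> finite {n. B n \<inter> W \<noteq> {}})"

definition countable_union_of :: "('a set \<Rightarrow> bool) \<Rightarrow> 'a set \<Rightarrow> bool" where
  "countable_union_of P U \<longleftrightarrow> (\<exists>\<W>. countable \<W> \<and> (\<forall>W\<in>\<W>. P W) \<and> U = \<Union>\<W>)"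

end

theory Submission
  imports Defs "HOL-Library.Nat_Bijection"
begin

text \<open>
  A level of a tree as in (3) is dispersed: the tails of a necklace are connected, so a tail with
  two vertices on one level also has a vertex on a lower level. A fat $TK_{\aleph_0}$ with
  infinitely many branch sets meeting \<open>W\<close> contains a necklace made of links that meets \<open>W\<close>
  infinitely often, so (4) implies (5).

  For (5) implies (1), build the tree downwards from \<open>r\<close>: below the path \<open>t\<^sub>0, \<dots>, t\<^sub>n\<close>, select one
  vertex in each component of \<open>S - {t\<^sub>0, \<dots>, t\<^sub>n}\<close> inside the component in which \<open>t\<^sub>n\<close> was selected.
  Every such selection yields a weak normal tree. By bookkeeping, the selection exhausts along each
  infinite branch a countable set \<open>Y\<close> that is closed under two kinds of witnesses: maximal countable
  families of internally disjoint links between two finite sets, and finite connected sets that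
  extend a given finite set, avoid another one and meet a given member of the union in (5). Exhaustion
  gives a necklace inside \<open>Y\<close> through the branch. If some \<open>u\<close> in a member \<open>W\<close> of that union were
  never selected, it would join pairwise disjoint connected subsets of \<open>Y\<close> meeting \<open>W\<close> by links that
  otherwise avoid \<open>Y\<close>, and by maximality this makes those sets the branch sets of a fat
  $TK_{\aleph_0}$.
\<close>

section \<open>Connected sets and components\<close>

text \<open>For \<open>s\<close> in \<open>X\<close> no connected set qualifies, so the component is
  empty.\<close>

definition component :: "'a set set \<Rightarrow> 'a set \<Rightarrow> 'a \<Rightarrow> 'a set" where
  "component \<C> X s = \<Union>{C \<in> \<C>. s \<in> C \<and> C \<inter> X = {}}"

locale connectoid_space =
  fixes S :: "'a set" and \<C> :: "'a set set"
  assumes connectoid: "connectoid S \<C>"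
begin

lemma connected_subset: "C \<in> \<C> \<Longrightarrow> C \<subseteq> S"
  using connectoid by (auto simp: connectoid_def induced_connected_sets_def)

lemma generating_familyE:
  obtains \<F> where "generating_family S \<F>"
    and "\<And>C. C \<in> \<C> \<longleftrightarrow> C \<subseteq> S \<and> (\<forall>x\<in>C. \<forall>y\<in>C. \<exists>F\<in>\<F>. F \<subseteq> C \<and> x \<in> F \<and> y \<in> F)"
proof -
  obtain \<F> where F: "generating_family S \<F>" and C: "\<C> = induced_connected_sets S \<F>"
    using connectoid by (auto simp: connectoid_def)
  show thesis
    by (rule that[OF F]) (simp add: C induced_connected_sets_def)
qed

lemma singleton_connected:
  assumes "s \<in> S" shows "{s} \<in> \<C>"
proof (rule generating_familyE)
  fix \<F>
  assume "generating_family S \<F>"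
    and C: "\<And>C. C \<in> \<C> \<longleftrightarrow> C \<subseteq> S \<and> (\<forall>x\<in>C. \<forall>y\<in>C. \<exists>F\<in>\<F>. F \<subseteq> C \<and> x \<in> F \<and> y \<in> F)"
  then have "{s} \<in> \<F>" using assms by (simp add: generating_family_def)
  then show ?thesis using assms by (subst C) blast
qed

lemma empty_connected: "{} \<in> \<C>"
  using connectoid by (auto simp: connectoid_def induced_connected_sets_def)

text \<open>Generating sets that join \<open>y\<close> and \<open>z\<close> to the common point
  \<open>x\<close> overlap in \<open>x\<close>, so their union is again a generating set.\<close>

lemma Union_connected:
  assumes sub: "\<A> \<subseteq> \<C>" and x: "\<And>A. A \<in> \<A> \<Longrightarrow> x \<in> A"
  shows "\<Union>\<A> \<in> \<C>"
proof (rule generating_familyE)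
  fix \<F>
  assume F: "generating_family S \<F>"
    and C: "\<And>C. C \<in> \<C> \<longleftrightarrow> C \<subseteq> S \<and> (\<forall>x\<in>C. \<forall>y\<in>C. \<exists>F\<in>\<F>. F \<subseteq> C \<and> x \<in> F \<and> y \<in> F)"
  show ?thesis
    unfolding C
  proof (intro conjI ballI)
    show "\<Union>\<A> \<subseteq> S" using sub connected_subset by blast
    fix y z assume "y \<in> \<Union>\<A>" "z \<in> \<Union>\<A>"
    then obtain A B where AB: "A \<in> \<A>" "y \<in> A" "B \<in> \<A>" "z \<in> B" by blast
    obtain F where F1: "F \<in> \<F>" "F \<subseteq> A" "x \<in> F" "y \<in> F"
      using C[of A] AB sub x by blast
    obtain G where G1: "G \<in> \<F>" "G \<subseteq> B" "x \<in> G" "z \<in> G"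
      using C[of B] AB sub x by blast
    have "F \<union> G \<in> \<F>" using F F1 G1 unfolding generating_family_def by blast
    then show "\<exists>F\<in>\<F>. F \<subseteq> \<Union>\<A> \<and> y \<in> F \<and> z \<in> F"
      using F1 G1 AB by (intro bexI[of _ "F \<union> G"]) auto
  qed
qed

lemma Un_connected:
  assumes "C \<in> \<C>" "D \<in> \<C>" "C \<inter> D \<noteq> {}"
  shows "C \<union> D \<in> \<C>"
proof -
  obtain x where "x \<in> C" "x \<in> D" using assms by auto
  then show ?thesis using Union_connected[of "{C, D}" x] assms by auto
qed

text \<open>With \<open>a\<close> in \<open>A\<close> fixed, each element of \<open>A\<close> is
  joined to \<open>a\<close> by a finite generating set inside \<open>C\<close>; these finitely many
  sets share \<open>a\<close>.\<close>

lemma finite_connected_between: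
  assumes "C \<in> \<C>" "finite A" "A \<subseteq> C"
  obtains F where "finite F" "F \<in> \<C>" "A \<subseteq> F" "F \<subseteq> C"
proof (cases "A = {}")
  case True
  then show ?thesis using that[of "{}"] empty_connected by auto
next
  case False
  then obtain a where a: "a \<in> A" by auto
  show ?thesis
  proof (rule generating_familyE)
    fix \<F>
    assume F: "generating_family S \<F>"
      and C: "\<And>C. C \<in> \<C> \<longleftrightarrow> C \<subseteq> S \<and> (\<forall>x\<in>C. \<forall>y\<in>C. \<exists>F\<in>\<F>. F \<subseteq> C \<and> x \<in> F \<and> y \<in> F)"
    have "\<forall>x\<in>A. \<exists>F. F \<in> \<F> \<and> F \<subseteq> C \<and> a \<in> F \<and> x \<in> F"
      using assms a C[of C] by blast
    then obtain G where G: "\<forall>x\<in>A. G x \<in> \<F> \<and> G x \<subseteq> C \<and> a \<in> G x \<and> x \<in> G x"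
      by (rule bchoice[THEN exE])
    have fam: "F \<in> \<C>" "finite F" if "F \<in> \<F>" for F
      using F that unfolding generating_family_def C by blast+
    show thesis
    proof (rule that)
      show "\<Union>(G ` A) \<in> \<C>" using G fam by (intro Union_connected[of _ a]) auto
      show "finite (\<Union>(G ` A))" using G fam assms(2) by auto
      show "A \<subseteq> \<Union>(G ` A)" "\<Union>(G ` A) \<subseteq> C" using G by blast+
    qed
  qed
qed

section \<open>Chains of connected sets and necklaces\<close>

lemma chain_Union_connected:
  assumes H: "\<And>n. H n \<in> \<C>" and meet: "\<And>n::nat. H n \<inter> H (Suc n) \<noteq> {}"
  shows "(\<Union>n. H n) \<in> \<C>"
proof -
  obtain x where x: "x \<in> H 0" using meet[of 0] by auto
  have part: "(\<Union>i\<le>n. H i) \<in> \<C>" for n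
  proof (induction n)
    case 0
    then show ?case using H by simp
  next
    case (Suc n)
    have "(\<Union>i\<le>n. H i) \<union> H (Suc n) \<in> \<C>"
      using Suc H meet[of n] by (intro Un_connected) auto
    then show ?case by (simp add: atMost_Suc Un_commute)
  qed
  have "\<Union>(range (\<lambda>n. \<Union>i\<le>n. H i)) \<in> \<C>"
    using part x by (intro Union_connected[of _ x]) auto
  moreover have "\<Union>(range (\<lambda>n. \<Union>i\<le>n. H i)) = (\<Union>n. H n)" by auto
  ultimately show ?thesis by simp
qed

lemma necklace_UnionI:
  assumes H: "\<And>n. finite (H n)" "\<And>n. H n \<in> \<C>"
    and meet: "\<And>n::nat. H n \<inter> H (Suc n) \<noteq> {}"
    and disj: "\<And>i j. i + 2 \<le> j \<Longrightarrow> H i \<inter> H j = {}"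
  shows "necklace \<C> (\<Union>n. H n)"
proof -
  have "H i \<inter> H j \<noteq> {} \<longleftrightarrow> \<bar>int i - int j\<bar> \<le> 1" for i j
  proof -
    consider "i + 2 \<le> j" | "j + 2 \<le> i" | "j = Suc i" | "i = Suc j" | "i = j" by linarith
    then show ?thesis
    proof cases
      case 1
      then show ?thesis using disj[of i j] by auto
    next
      case 2
      then show ?thesis using disj[of j i] by auto
    qed (use meet[of i] meet[of j] in auto)
  qed
  then show ?thesis
    unfolding necklace_def using chain_Union_connected[of H, OF H(2) meet] H
    by (intro conjI exI[of _ H] allI) simp_all
qed

section \<open>Components outside a set\<close>

lemma component_connected: "component \<C> X s \<in> \<C>"
  unfolding component_def by (rule Union_connected) auto

lemma component_subset: "component \<C> X s \<subseteq> S"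
  using component_connected connected_subset by blast

lemma component_disjoint: "component \<C> X s \<inter> X = {}"
  by (auto simp: component_def)

lemma component_self: "s \<in> S \<Longrightarrow> s \<notin> X \<Longrightarrow> s \<in> component \<C> X s"
  using singleton_connected by (auto simp: component_def)

lemma component_antimono: "X \<subseteq> Y \<Longrightarrow> component \<C> Y s \<subseteq> component \<C> X s"
  by (auto simp: component_def)

text \<open>The component of \<open>s\<close> is one of the sets whose union is the component of
  \<open>t\<close>. Hence \<open>s\<close> lies in the latter, and the roles can be
  exchanged.\<close>

lemma component_eq:
  assumes t: "t \<in> component \<C> X s"
  shows "component \<C> X t = component \<C> X s"
proof -
  let ?K = "component \<C> X"
  have s: "s \<in> ?K s" using t by (auto simp: component_def)
  have "?K s \<subseteq> ?K t"
    using t component_connected[of X s] component_disjoint[of X s]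
    by (auto simp: component_def[of \<C> X t])
  moreover from this have "?K t \<subseteq> ?K s"
    using s component_connected[of X t] component_disjoint[of X t]
    by (auto simp: component_def[of \<C> X s])
  ultimately show ?thesis by auto
qed

lemma component_maximal:
  assumes "C \<in> \<C>" "C \<inter> X = {}" "C \<inter> component \<C> X s \<noteq> {}"
  shows "C \<subseteq> component \<C> X s"
proof -
  obtain x where x: "x \<in> C" "x \<in> component \<C> X s" using assms by auto
  have "C \<subseteq> component \<C> X x" using assms x by (auto simp: component_def)
  then show ?thesis using component_eq[OF x(2)] by simp
qed

end


section \<open>Paths in rooted trees\<close>

lemma adjacent_commute: "adjacent T u v \<longleftrightarrow> adjacent T v u"
  by (simp add: adjacent_def insert_commute)

lemma successively_adjacent_rev: "successively (adjacent T) (rev p) \<longleftrightarrow> successively (adjacent T) p"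
proof -
  have "(\<lambda>x y. adjacent T y x) = adjacent T" by (intro ext) (rule adjacent_commute)
  then show ?thesis unfolding successively_rev by (rule arg_cong)
qed

lemma successively_infix: "successively P (xs @ ys @ zs) \<Longrightarrow> successively P ys"
  by (simp add: successively_append_iff)

lemma graph_path_prefix:
  assumes "graph_path T r (p @ x # q) v"
  shows "graph_path T r (p @ [x]) x"
  using assms successively_infix[of "adjacent T" "[]" "p @ [x]" q]
  by (cases p) (auto simp: graph_path_def)

text \<open>Two different paths with the same ends close up a cycle: they part after a common prefix
  \<open>c\<close>, and the first vertex of one remainder that lies on the other brings them
  together again.\<close>

lemma root_path_unique:
  assumes nocycle: "\<nexists>p. graph_cycle T p"
    and p: "graph_path T r p v" and q: "graph_path T r q v"
  shows "p = q"
proof (rule ccontr)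
  assume "p \<noteq> q"
  obtain c a b where c: "p = c @ a" "q = c @ b" "a = [] \<or> b = [] \<or> hd a \<noteq> hd b"
    using longest_common_prefix[of p q] by metis
  have ends: "hd p = hd q" "last p = last q" "distinct p" "distinct q" "p \<noteq> []" "q \<noteq> []"
    using p q by (auto simp: graph_path_def)
  have "c \<noteq> []" using c ends by auto
  have "a \<noteq> []"
  proof
    assume "a = []"
    then have "b \<noteq> []" using c \<open>p \<noteq> q\<close> by auto
    then have "last q \<in> set b" "last p \<in> set c" using c \<open>a = []\<close> \<open>c \<noteq> []\<close> by auto
    then show False using ends c by auto
  qed
  moreover have "b \<noteq> []"
  proof
    assume "b = []"
    then have "last p \<in> set a" "last q \<in> set c" using c \<open>a \<noteq> []\<close> \<open>c \<noteq> []\<close> by auto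
    then show False using ends c by auto
  qed
  ultimately have hd: "hd a \<noteq> hd b"
    using c by auto
  have "last a \<in> set a \<inter> set b"
    using c ends \<open>a \<noteq> []\<close> \<open>b \<noteq> []\<close> last_in_set[of a] last_in_set[of b] by simp
  then obtain a1 x a2 where a: "a = a1 @ x # a2" "x \<in> set b" "\<And>y. y \<in> set a1 \<Longrightarrow> y \<notin> set b"
    using split_list_first_prop[of a "\<lambda>y. y \<in> set b"] by blast
  obtain b1 b2 where b: "b = b1 @ x # b2" using a(2) by (meson split_list)
  \<comment> \<open>The cycle leaves \<open>last c\<close> along \<open>a\<close> up to
    \<open>x\<close> and returns along \<open>b\<close>. It has at least three vertices:
    \<open>hd a\<close> and \<open>hd b\<close> differ, so \<open>a1\<close> and \<open>b1\<close>
    are not both empty.\<close>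
  let ?z = "last c # a1 @ x # rev b1"
  obtain d where d: "c = d @ [last c]" using \<open>c \<noteq> []\<close> by (metis append_butlast_last_id)
  have "successively (adjacent T) (d @ (last c # a1 @ [x]) @ a2)"
    using p c a d by (metis append.assoc append_Cons append_Nil graph_path_def)
  then have sa: "successively (adjacent T) ((last c # a1) @ [x])"
    using successively_infix[of "adjacent T" d "last c # a1 @ [x]" a2] by simp
  have "successively (adjacent T) (d @ (last c # b1 @ [x]) @ b2)"
    using q c b d by (metis append.assoc append_Cons append_Nil graph_path_def)
  then have "successively (adjacent T) (last c # b1 @ [x])"
    by (rule successively_infix)
  then have sb: "successively (adjacent T) ((x # rev b1) @ [last c])"
    using successively_adjacent_rev[of T "last c # b1 @ [x]"] by simp
  have "successively (adjacent T) (x # rev b1)" "adjacent T (last (x # rev b1)) (last c)"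
    using sb unfolding successively_append_iff by simp_all
  moreover from this(1) have "successively (adjacent T) ((last c # a1) @ (x # rev b1))"
    using sa unfolding successively_append_iff by simp
  ultimately have "successively (adjacent T) ?z" "adjacent T (last ?z) (hd ?z)"
    by (simp_all del: last.simps) (simp split: if_splits)
  moreover have "distinct ?z"
    using ends c a b last_in_set[OF \<open>c \<noteq> []\<close>] by auto
  moreover have "length ?z \<ge> 3"
    using hd a b by (cases a1; cases b1) auto
  ultimately have "graph_cycle T ?z" by (simp add: graph_cycle_def)
  then show False using nocycle by auto
qed

lemma tree_le_iff_set:
  assumes "rooted_tree T" "graph_path T (groot T) p v"
  shows "tree_le T u v \<longleftrightarrow> u \<in> set p"
  using assms root_path_unique[of T] by (auto simp: tree_le_def rooted_tree_def)

section \<open>Dispersed sets\<close>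

lemma finite_uniform_bound:
  assumes "finite A" "\<And>x. x \<in> A \<Longrightarrow> \<exists>k::nat. \<forall>j\<ge>k. P x j"
  obtains k where "\<And>x j. x \<in> A \<Longrightarrow> j \<ge> k \<Longrightarrow> P x j"
proof -
  have "\<exists>k. \<forall>x\<in>A. \<forall>j\<ge>k. P x j"
    using assms
  proof (induction A rule: finite_induct)
    case (insert a A)
    have "\<exists>k. \<forall>x\<in>A. \<forall>j\<ge>k. P x j" by (rule insert.IH) (simp add: insert.prems)
    moreover have "\<exists>l. \<forall>j\<ge>l. P a j" by (simp add: insert.prems)
    ultimately obtain k l where "\<forall>x\<in>A. \<forall>j\<ge>k. P x j" "\<forall>j\<ge>l. P a j" by blast
    then have "\<forall>x\<in>insert a A. \<forall>j\<ge>max k l. P x j" by auto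
    then show ?case by blast
  qed auto
  then show thesis using that by blast
qed

text \<open>Otherwise each \<open>A i\<close> has a point of \<open>X\<close> outside
  \<open>E\<close>. Since two members meet only inside \<open>E\<close>, these points are distinct
  and embed \<open>I\<close> in the finite set \<open>X\<close>.\<close>

lemma infinite_family_avoids_finite:
  assumes "infinite I" "finite X"
    and "\<And>i j. i \<in> I \<Longrightarrow> j \<in> I \<Longrightarrow> i \<noteq> j \<Longrightarrow> A i \<inter> A j \<subseteq> E"
  obtains i where "i \<in> I" "A i \<inter> X \<subseteq> E"
proof (rule ccontr)
  assume "\<not> thesis"
  then have "\<forall>i\<in>I. \<exists>x. x \<in> A i \<inter> X - E" using that by blast
  then obtain f where f: "\<forall>i\<in>I. f i \<in> A i \<inter> X - E" by (rule bchoice[THEN exE])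
  then have "inj_on f I" using assms(3) by (fastforce intro!: inj_onI)
  moreover have "f ` I \<subseteq> X" using f by auto
  ultimately show False using assms(1,2) by (meson finite_imageD finite_subset)
qed

text \<open>Levels count vertices, not edges: the root of a rooted tree is on level 1, and level 0
  is empty.\<close>

definition level :: "'a rooted_graph \<Rightarrow> nat \<Rightarrow> 'a set" where
  "level T n = {v. \<exists>p. graph_path T (groot T) p v \<and> length p = n}"

lemma level_lower:
  assumes "rooted_tree T" "tree_le T w u" "w \<noteq> u" "u \<in> level T n"
  shows "\<exists>m<n. w \<in> level T m"
proof -
  obtain p where p: "graph_path T (groot T) p u" "length p = n"
    using assms by (auto simp: level_def)
  then have "w \<in> set p" using assms tree_le_iff_set by metis
  then obtain p1 p2 where s: "p = p1 @ w # p2" by (meson split_list)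
  then have "p2 \<noteq> []" using p assms(3) by (auto simp: graph_path_def)
  then have "length (p1 @ [w]) < n" using p s by auto
  moreover have "w \<in> level T (length (p1 @ [w]))"
    using graph_path_prefix[of T "groot T" p1 w p2 u] p(1) s unfolding level_def by blast
  ultimately show ?thesis by blast
qed

lemma level_inject:
  assumes "rooted_tree T" "u \<in> level T m" "u \<in> level T n"
  shows "m = n"
  using assms root_path_unique[of T] by (auto simp: level_def rooted_tree_def)

lemma level_incomparable:
  assumes "rooted_tree T" "u \<in> level T n" "v \<in> level T n" "u \<noteq> v"
  shows "tree_incomparable T u v"
  unfolding tree_incomparable_def
  using assms level_lower level_inject by (metis less_irrefl)

lemma vertex_in_level:
  assumes "rooted_tree T" "v \<in> gverts T"
  shows "\<exists>n. v \<in> level T n"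
  using assms by (auto simp: rooted_tree_def level_def)

lemma level_subset: "level T n \<subseteq> gverts T"
  by (auto simp: level_def graph_path_def)

context connectoid_space
begin

text \<open>Induction on the level. Only finitely many vertices of the necklace are on lower levels,
  and each lies in only finitely many \<open>H j\<close>, so some tail avoids them all. This tail is
  connected, so it has at most one vertex on level \<open>n\<close>: two would have a lower vertex
  of the tail below both. The discarded beads are finite.\<close>

lemma necklace_meets_level_finitely:
  assumes T: "rooted_tree T" "separates_incomparable \<C> T" and N: "necklace \<C> N"
  shows "finite (N \<inter> level T n)"
proof (induction n rule: less_induct)
  case (less n)
  obtain H :: "nat \<Rightarrow> 'a set" where H: "\<And>n. finite (H n)" "\<And>n. H n \<in> \<C>" "N = (\<Union>n. H n)"
    and meet: "\<And>i j. H i \<inter> H j \<noteq> {} \<longleftrightarrow> \<bar>int i - int j\<bar> \<le> 1"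
  proof -
    obtain H :: "nat \<Rightarrow> 'a set" where "(\<forall>n. finite (H n) \<and> H n \<in> \<C>) \<and> N = (\<Union>n. H n) \<and>
        (\<forall>i j. H i \<inter> H j \<noteq> {} \<longleftrightarrow> \<bar>int i - int j\<bar> \<le> 1)"
      using N unfolding necklace_def by (elim conjE exE) (rule that, simp)
    then show thesis by (intro that[of H]) simp_all
  qed
  let ?Z = "N \<inter> (\<Union>m<n. level T m)"
  have "finite (\<Union>m<n. N \<inter> level T m)" using less by blast
  then have "finite ?Z" by (simp only: Int_UN_distrib)
  moreover have "\<exists>k. \<forall>j\<ge>k. x \<notin> H j" if "x \<in> ?Z" for x
  proof -
    have "x \<in> (\<Union>n. H n)" using that H(3) by simp
    then obtain i where i: "x \<in> H i" by (rule UN_E)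
    have "x \<notin> H j" if "j \<ge> i + 2" for j
    proof -
      have "H i \<inter> H j = {}" using meet[of i j] that by simp
      then show ?thesis using i by blast
    qed
    then show ?thesis by blast
  qed
  ultimately obtain k where k: "\<And>x j. x \<in> ?Z \<Longrightarrow> j \<ge> k \<Longrightarrow> x \<notin> H j"
    using finite_uniform_bound[of ?Z "\<lambda>x j. x \<notin> H j"] by blast
  let ?N = "\<Union>i. H (k + i)"
  have tail: "?N \<in> \<C>"
  proof (rule chain_Union_connected)
    show "H (k + i) \<inter> H (k + Suc i) \<noteq> {}" for i using meet by simp
  qed (rule H(2))
  show ?case
  proof (rule ccontr)
    assume inf: "infinite (N \<inter> level T n)"
    have "N \<subseteq> ?N \<union> (\<Union>i<k. H i)"
    proof
      fix x assume "x \<in> N"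
      then obtain i where i: "x \<in> H i" unfolding H(3) by (rule UN_E)
      show "x \<in> ?N \<union> (\<Union>i<k. H i)"
      proof (cases "i < k")
        case False
        then have "x \<in> H (k + (i - k))" using i by simp
        then show ?thesis by blast
      qed (use i in auto)
    qed
    then have "N \<inter> level T n \<subseteq> (?N \<inter> level T n) \<union> (\<Union>i<k. H i)" by auto
    moreover have "finite (\<Union>i<k. H i)" using H(1) by blast
    ultimately have "infinite (?N \<inter> level T n)" using inf by (meson finite_UnI finite_subset)
    then obtain u where u: "u \<in> ?N \<inter> level T n" by (metis all_not_in_conv finite.emptyI)
    have "infinite (?N \<inter> level T n - {u})"
      using \<open>infinite (?N \<inter> level T n)\<close> by simp
    then obtain v where v: "v \<in> ?N \<inter> level T n - {u}" by (metis all_not_in_conv finite.emptyI)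
    have uv: "u \<in> ?N \<inter> level T n" "v \<in> ?N \<inter> level T n" "u \<noteq> v" using u v by auto
    have inc: "tree_incomparable T u v"
      using level_incomparable[OF T(1), of u n v] uv by blast
    have "u \<in> ?N \<inter> gverts T" "v \<in> ?N \<inter> gverts T" using uv level_subset[of T n] by auto
    then obtain w where w: "w \<in> ?N" "tree_le T w u" "tree_le T w v"
      using T(2) tail inc unfolding separates_incomparable_def by blast
    \<comment> \<open>\<open>w = u\<close> would put \<open>u\<close> below
      \<open>v\<close>.\<close>
    then have "w \<noteq> u" using inc
      by (auto simp: tree_incomparable_def)
    then obtain m where "m < n" "w \<in> level T m" using level_lower[OF T(1) w(2)] uv by blast
    moreover have "w \<in> N" using w(1) unfolding H(3) by blast
    ultimately have "w \<in> ?Z" by blast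
    then show False using k w(1) by (metis UN_iff le_add1)
  qed
qed

lemma countable_union_of_dispersed:
  assumes T: "rooted_tree T" "separates_incomparable \<C> T" "gverts T \<subseteq> S" and U: "U \<subseteq> gverts T"
  shows "countable_union_of (dispersed S \<C>) U"
  unfolding countable_union_of_def
proof (intro exI conjI ballI)
  show "countable (range (\<lambda>n. U \<inter> level T n))" by simp
  show "U = \<Union>(range (\<lambda>n. U \<inter> level T n))" using U vertex_in_level[OF T(1)] by blast
  fix W assume "W \<in> range (\<lambda>n. U \<inter> level T n)"
  then obtain n where n: "W = U \<inter> level T n" by auto
  have "finite (N \<inter> W)" if "necklace \<C> N" for N
    using necklace_meets_level_finitely[OF T(1,2) that, of n] by (rule finite_subset[rotated]) (auto simp: n)
  then show "dispersed S \<C> W" using U T n by (auto simp: dispersed_def)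
qed

text \<open>A necklace is threaded through infinitely many branch sets that meet \<open>W\<close>,
  each bead after the first being a link between consecutive ones. Only finitely many elements have
  been used at any stage, which leaves a fresh branch set and a fresh link.\<close>

lemma dispersed_imp_fat_TK_dispersed:
  assumes W: "dispersed S \<C> W"
  shows "fat_TK_dispersed S \<C> W"
  unfolding fat_TK_dispersed_def
proof (intro conjI allI impI)
  show "W \<subseteq> S" using W by (simp add: dispersed_def)
  fix B \<L> assume TK: "fat_TK \<C> B \<L>"
  let ?I = "{n. B n \<inter> W \<noteq> {}}"
  show "finite ?I"
  proof (rule ccontr)
    assume inf: "infinite ?I"
    have B: "\<And>n. finite (B n)" "\<And>n. B n \<in> \<C>" "\<And>n m. n \<noteq> m \<Longrightarrow> B n \<inter> B m = {}"
      using TK by (auto simp: fat_TK_def)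
    have L: "uncountable (\<L> n m)" "\<And>L. L \<in> \<L> n m \<Longrightarrow> XY_link \<C> (B n) (B m) L"
      "\<And>L L'. L \<in> \<L> n m \<Longrightarrow> L' \<in> \<L> n m \<Longrightarrow> L \<noteq> L' \<Longrightarrow> L \<inter> L' \<subseteq> B n \<union> B m" if "n \<noteq> m" for n m
      using TK that unfolding fat_TK_def by blast+
    \<comment> \<open>In a state \<open>(b, L, Z)\<close>, \<open>L\<close> is the current bead,
      \<open>Z\<close> the union of all earlier beads, and \<open>B b\<close> the part of
      \<open>L\<close> to which the next bead attaches. The next bead may meet \<open>L\<close> but
      not \<open>Z\<close>.\<close>
    define P where "P = (\<lambda>(n::nat) (b, L, Z). b \<in> ?I \<and> finite L \<and> L \<in> \<C> \<and> finite Z \<and>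
      B b \<inter> Z = {} \<and> B b \<subseteq> L)"
    define Q where "Q = (\<lambda>(n::nat) (b, L, Z) (b'::nat, L', Z'). B b \<subseteq> L' \<and> Z' = Z \<union> L \<and> L' \<inter> Z = {})"
    have "\<exists>f. \<forall>n. P n (f n) \<and> Q n (f n) (f (Suc n))"
    proof (rule dependent_nat_choice)
      obtain b where "b \<in> ?I" using inf by (metis all_not_in_conv finite.emptyI)
      then show "\<exists>x. P 0 x" using B by (intro exI[of _ "(b, B b, {})"]) (auto simp: P_def)
    next
      fix x n assume "P n x"
      then obtain b L Z where x: "x = (b, L, Z)" and b: "b \<in> ?I" "finite L" "L \<in> \<C>" "finite Z"
        "B b \<inter> Z = {}" "B b \<subseteq> L" by (cases x) (auto simp: P_def)
      have fin: "finite (Z \<union> L)" using b by simp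
      obtain b' where b': "b' \<in> ?I" "B b' \<inter> (Z \<union> L) \<subseteq> {}"
        using infinite_family_avoids_finite[OF inf fin, of B "{}"] B(3) by blast
      then have ne: "b \<noteq> b'" using b by auto
      have "infinite (\<L> b b')" using L(1)[OF ne] countable_finite by blast
      \<comment> \<open>The links are disjoint outside the two branch sets, so one of them misses
        \<open>Z \<union> L\<close> there. As both branch sets miss \<open>Z\<close>, so does this
        link.\<close>
      from infinite_family_avoids_finite[OF this fin, of "\<lambda>x. x" "B b \<union> B b'"] L(3)[OF ne]
      obtain L' where L': "L' \<in> \<L> b b'" "L' \<inter> (Z \<union> L) \<subseteq> B b \<union> B b'" by blast
      have l: "XY_link \<C> (B b) (B b') L'" using L(2)[OF ne L'(1)] .
      then have sub: "B b \<subseteq> L'" "B b' \<subseteq> L'" "finite L'" "L' \<in> \<C>" by (auto simp: XY_link_def)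
      have "L' \<inter> Z = {}" using L'(2) b(5) b'(2) by auto
      then show "\<exists>y. P (Suc n) y \<and> Q n x y"
        using sub fin b'
        by (intro exI[of _ "(b', L', Z \<union> L)"]) (auto simp: P_def Q_def x)
    qed
    then obtain f where f: "\<And>n. P n (f n)" "\<And>n. Q n (f n) (f (Suc n))" by blast
    define b H Z where "b = (\<lambda>n. fst (f n))" and "H = (\<lambda>n. fst (snd (f n)))"
      and "Z = (\<lambda>n. snd (snd (f n)))"
    have fn: "f n = (b n, H n, Z n)" for n by (simp add: b_def H_def Z_def)
    have P: "b n \<in> ?I" "finite (H n)" "H n \<in> \<C>" "B (b n) \<inter> Z n = {}" "B (b n) \<subseteq> H n" for n
      using f(1)[of n] by (auto simp: P_def fn)
    have Q: "B (b n) \<subseteq> H (Suc n)" "Z (Suc n) = Z n \<union> H n" "H (Suc n) \<inter> Z n = {}" for n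
      using f(2)[of n] by (auto simp: Q_def fn)
    have Zmono: "H i \<subseteq> Z j" if "i < j" for i j
      using that by (induction j) (auto simp: Q less_Suc_eq)
    have "\<forall>n. \<exists>w. w \<in> B (b n) \<inter> W" using P(1) by blast
    then obtain w where w: "\<And>n. w n \<in> B (b n) \<inter> W" by metis
    have "necklace \<C> (\<Union>n. H n)"
    proof (rule necklace_UnionI)
      show "H n \<inter> H (Suc n) \<noteq> {}" for n using P(5)[of n] Q(1)[of n] w[of n] by auto
      show "H i \<inter> H j = {}" if "i + 2 \<le> j" for i j
        using Zmono[of i "j - 1"] Q(3)[of "j - 1"] that by (cases j) auto
    qed (use P in auto)
    then have "finite ((\<Union>n. H n) \<inter> W)" using W by (simp add: dispersed_def)
    moreover have "range w \<subseteq> (\<Union>n. H n) \<inter> W" using w P(5) by blast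
    moreover have "inj w"
    proof (rule linorder_injI)
      fix i j :: nat assume "i < j"
      then have "w i \<in> Z j" using w[of i] P(5)[of i] Zmono by blast
      then show "w i \<noteq> w j" using w[of j] P(4)[of j] by auto
    qed
    ultimately show False using finite_subset range_inj_infinite by blast
  qed
qed

end

section \<open>Trees from prefix-closed families of paths\<close>

text \<open>\<open>\<pi> v\<close> is to become the path from the root to \<open>v\<close>. By the
  last assumption each nonempty initial segment of a path is the path of its own last vertex, so the
  tree-order will be the prefix order.\<close>

locale path_system =
  fixes V :: "'a set" and \<pi> :: "'a \<Rightarrow> 'a list" and r :: 'a
  assumes root_path: "r \<in> V" "\<pi> r = [r]"
    and hd_path: "v \<in> V \<Longrightarrow> hd (\<pi> v) = r"
    and last_path: "v \<in> V \<Longrightarrow> \<pi> v \<noteq> [] \<and> last (\<pi> v) = v"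
    and prefix_path: "v \<in> V \<Longrightarrow> i < length (\<pi> v) \<Longrightarrow>
      \<pi> v ! i \<in> V \<and> \<pi> (\<pi> v ! i) = take (Suc i) (\<pi> v)"
begin

definition tree :: "'a rooted_graph" where
  "tree = \<lparr>gverts = V, gedges = {{u, v} | u v. u \<in> V \<and> v \<in> V \<and> \<pi> v = \<pi> u @ [v]}, groot = r\<rparr>"

lemma tree_simps [simp]: "gverts tree = V" "groot tree = r"
  by (simp_all add: tree_def)

lemma adjacent_tree:
  "adjacent tree u v \<longleftrightarrow> u \<in> V \<and> v \<in> V \<and> (\<pi> v = \<pi> u @ [v] \<or> \<pi> u = \<pi> v @ [u])"
  unfolding adjacent_def tree_def by (auto simp: doubleton_eq_iff)

lemma set_path: "v \<in> V \<Longrightarrow> set (\<pi> v) \<subseteq> V"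
  using prefix_path by (auto simp: set_conv_nth)

lemma path_mem:
  assumes "v \<in> V" "u \<in> set (\<pi> v)"
  shows "\<exists>q. \<pi> v = \<pi> u @ q"
proof -
  obtain i where i: "i < length (\<pi> v)" "\<pi> v ! i = u" using assms(2) by (auto simp: in_set_conv_nth)
  then have "\<pi> u = take (Suc i) (\<pi> v)" using prefix_path[OF assms(1) i(1)] by simp
  then show ?thesis by (metis append_take_drop_id)
qed

text \<open>A repeated vertex would have two prefixes of different lengths as its path.\<close>

lemma distinct_path:
  assumes "v \<in> V" shows "distinct (\<pi> v)"
  unfolding distinct_conv_nth
proof (intro allI impI notI)
  fix i j assume ij: "i < length (\<pi> v)" "j < length (\<pi> v)" "i \<noteq> j" "\<pi> v ! i = \<pi> v ! j"
  then have "take (Suc i) (\<pi> v) = take (Suc j) (\<pi> v)"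
    using prefix_path[OF assms ij(1)] prefix_path[OF assms ij(2)] by metis
  then have "length (take (Suc i) (\<pi> v)) = length (take (Suc j) (\<pi> v))" by simp
  then show False using ij by simp
qed

lemma successively_path:
  assumes "v \<in> V" shows "successively (adjacent tree) (\<pi> v)"
  unfolding successively_conv_nth
proof (intro allI impI)
  fix i assume i: "Suc i < length (\<pi> v)"
  then have "\<pi> (\<pi> v ! i) = take (Suc i) (\<pi> v)" "\<pi> v ! i \<in> V"
    "\<pi> (\<pi> v ! Suc i) = take (Suc (Suc i)) (\<pi> v)" "\<pi> v ! Suc i \<in> V"
    using prefix_path[OF assms] by simp_all
  then show "adjacent tree (\<pi> v ! i) (\<pi> v ! Suc i)"
    using i by (simp add: adjacent_tree take_Suc_conv_app_nth)
qed

lemma graph_path_root: "v \<in> V \<Longrightarrow> graph_path tree r (\<pi> v) v"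
  using set_path distinct_path successively_path hd_path last_path by (simp add: graph_path_def)

text \<open>Take a vertex of the cycle with a longest root path. Both its neighbours on the cycle
  have this path without its last entry as their root path, so they coincide.\<close>

lemma no_cycle: "\<not> graph_cycle tree p"
proof
  assume c: "graph_cycle tree p"
  define n where "n = length p"
  have n: "n \<ge> 3" and d: "distinct p" and s: "successively (adjacent tree) p"
    and close: "adjacent tree (last p) (hd p)"
    using c by (auto simp: graph_cycle_def n_def)
  have "finite ((\<lambda>i. length (\<pi> (p ! i))) ` {..<n})" "(\<lambda>i. length (\<pi> (p ! i))) ` {..<n} \<noteq> {}"
    using n by (auto simp: lessThan_empty_iff)
  then obtain i where i: "i < n" and max: "\<And>j. j < n \<Longrightarrow> length (\<pi> (p ! j)) \<le> length (\<pi> (p ! i))"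
    using Max_in Max_ge by (smt (verit) finite_imageI imageE image_eqI lessThan_iff)
  \<comment> \<open>Indices of the two neighbours, wrapping round at the ends of the list; they
    differ because the cycle has at least three vertices.\<close>
  define succ pred where "succ = (if Suc i = n then 0 else Suc i)" and "pred = (if i = 0 then n - 1 else i - 1)"
  have step: "adjacent tree (p ! j) (p ! Suc j)" if "Suc j < n" for j
    using s that by (simp add: successively_conv_nth n_def)
  have wrap: "adjacent tree (p ! (n - 1)) (p ! 0)"
    using close n by (simp add: n_def last_conv_nth hd_conv_nth flip: length_greater_0_conv)
  have adj1: "adjacent tree (p ! succ) (p ! i)"
    using step[of i] wrap i by (auto simp: succ_def adjacent_commute[of _ _ "p ! i"])
  have adj2: "adjacent tree (p ! pred) (p ! i)"
    using step[of "i - 1"] wrap i by (auto simp: pred_def)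
  have lt: "succ < n" "pred < n" "succ \<noteq> pred" using n i by (auto simp: succ_def pred_def)
  have up: "p ! j \<in> V \<and> \<pi> (p ! i) = \<pi> (p ! j) @ [p ! i]" if "j < n" "adjacent tree (p ! j) (p ! i)" for j
    using that(2) max[OF that(1)] unfolding adjacent_tree by auto
  have "p ! succ \<in> V" "p ! pred \<in> V" "\<pi> (p ! succ) = \<pi> (p ! pred)"
    using up[OF lt(1) adj1] up[OF lt(2) adj2] by simp_all
  then have "p ! succ = p ! pred" using last_path by metis
  then show False using d lt by (simp add: nth_eq_iff_index_eq n_def)
qed

text \<open>To connect \<open>u\<close> with \<open>v\<close>, descend from \<open>u\<close> to the
  last vertex of the longest common prefix of the root paths, then ascend to
  \<open>v\<close>.\<close>

lemma rooted_tree: "rooted_tree tree"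
  unfolding rooted_tree_def
proof (intro conjI ballI)
  fix e assume "e \<in> gedges tree"
  then obtain u v where uv: "e = {u, v}" "u \<in> V" "v \<in> V" "\<pi> v = \<pi> u @ [v]" by (auto simp: tree_def)
  then have "u \<noteq> v" by auto
  then show "\<exists>u\<in>gverts tree. \<exists>v\<in>gverts tree. u \<noteq> v \<and> e = {u, v}" using uv by auto
next
  fix u v assume uv: "u \<in> gverts tree" "v \<in> gverts tree"
  obtain c a b where c: "\<pi> u = c @ a" "\<pi> v = c @ b" "a = [] \<or> b = [] \<or> hd a \<noteq> hd b"
    using longest_common_prefix[of "\<pi> u" "\<pi> v"] by metis
  have V: "u \<in> V" "v \<in> V" using uv by auto
  have "c \<noteq> []" using c hd_path[OF V(1)] hd_path[OF V(2)] last_path[OF V(1)] last_path[OF V(2)] by auto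
  then obtain d z where z: "c = d @ [z]" by (metis rev_exhaust)
  \<comment> \<open>The root path of a common vertex \<open>x\<close> would be a prefix of both
    paths and longer than \<open>c\<close>, so \<open>a\<close> and \<open>b\<close> would start
    alike.\<close>
  have "set a \<inter> set b = {}"
  proof (rule ccontr)
    assume "set a \<inter> set b \<noteq> {}"
    then obtain x where x: "x \<in> set a" "x \<in> set b" by auto
    then obtain q q' where q: "\<pi> u = \<pi> x @ q" "\<pi> v = \<pi> x @ q'"
      using path_mem[OF V(1), of x] path_mem[OF V(2), of x] c by auto
    have xV: "x \<in> V" using set_path[OF V(1)] x c by auto
    have xc: "x \<notin> set c" using distinct_path[OF V(1)] c x by auto
    have "\<not> length (\<pi> x) \<le> length c"
    proof
      assume "length (\<pi> x) \<le> length c"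
      then obtain e where "c = \<pi> x @ e" using q(1) c(1) by (metis append_eq_append_conv_if append_take_drop_id)
      then show False using xc last_path[OF xV] last_in_set[of "\<pi> x"] by auto
    qed
    then obtain e where e: "\<pi> x = c @ e" "e \<noteq> []"
      using q(1) c(1) by (metis append_eq_append_conv_if append_take_drop_id nat_le_linear self_append_conv order_refl)
    then have "a = e @ q" "b = e @ q'" using q c by auto
    then show False using c(3) e(2) by auto
  qed
  moreover have "distinct (d @ z # a)" "distinct (d @ z # b)"
    using distinct_path[OF V(1)] distinct_path[OF V(2)] c z by auto
  ultimately have "distinct (rev a @ z # b)" by auto
  moreover have "successively (adjacent tree) (rev a @ z # b)"
  proof -
    have "successively (adjacent tree) (z # a)" "successively (adjacent tree) (z # b)"
      using successively_path[OF V(1)] successively_path[OF V(2)] c z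
      by (auto simp: successively_append_iff)
    then have "successively (adjacent tree) (rev (z # a))" "successively (adjacent tree) (z # b)"
      using successively_adjacent_rev by blast+
    then show ?thesis by (simp add: successively_append_iff)
  qed
  moreover have "set (rev a @ z # b) \<subseteq> V"
    using set_path[OF V(1)] set_path[OF V(2)] c z by auto
  moreover have "hd (rev a @ z # b) = u" "last (rev a @ z # b) = v"
    using last_path[OF V(1)] last_path[OF V(2)] c z by (cases a rule: rev_cases; auto)+
  ultimately have "graph_path tree u (rev a @ z # b) v" by (simp add: graph_path_def)
  then show "\<exists>p. graph_path tree u p v" by blast
qed (use no_cycle root_path in auto)

lemma tree_le_iff: "tree_le tree u v \<longleftrightarrow> v \<in> V \<and> u \<in> set (\<pi> v)"
proof
  assume le: "tree_le tree u v"
  then obtain p where "graph_path tree r p v" by (auto simp: tree_le_def)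
  then have "v \<in> V" by (auto simp: graph_path_def)
  then show "v \<in> V \<and> u \<in> set (\<pi> v)"
    using le tree_le_iff_set[OF rooted_tree] graph_path_root by auto
next
  assume "v \<in> V \<and> u \<in> set (\<pi> v)"
  then show "tree_le tree u v" using graph_path_root[of v] by (auto simp: tree_le_def)
qed

text \<open>Initial segments of a ray are graph paths from the root, and such paths are
  unique.\<close>

lemma path_rooted_ray:
  assumes R: "rooted_ray tree R"
  shows "R n \<in> V" "\<pi> (R n) = map R [0..<Suc n]"
proof -
  have inj: "inj R" and R0: "R 0 = r" and adj: "\<And>n. adjacent tree (R n) (R (Suc n))"
    using R by (auto simp: rooted_ray_def)
  have V: "R n \<in> V" for n using adj by (auto simp: adjacent_tree)
  then show "R n \<in> V" .
  have "graph_path tree r (map R [0..<Suc n]) (R n)"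
    unfolding graph_path_def
  proof (intro conjI)
    show "set (map R [0..<Suc n]) \<subseteq> gverts tree" using V by (simp only: set_map) auto
    show "distinct (map R [0..<Suc n])"
      using inj_on_subset[OF inj] by (simp add: distinct_map del: upt_Suc)
    show "successively (adjacent tree) (map R [0..<Suc n])"
      using adj by (auto simp: successively_conv_nth simp del: upt_Suc)
    show "hd (map R [0..<Suc n]) = r" using R0 by (simp add: upt_conv_Cons del: upt_Suc)
  qed auto
  then show "\<pi> (R n) = map R [0..<Suc n]"
    using root_path_unique[of tree] no_cycle graph_path_root[OF V] by blast
qed

end

section \<open>Selection trees\<close>

text \<open>\<open>sel xs D\<close> selects a vertex in the component \<open>D\<close> left below
  the path \<open>xs\<close>; its dependence on the whole history \<open>xs\<close> permits
  bookkeeping.\<close>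

locale selection = connectoid_space S \<C> for S :: "'a set" and \<C> :: "'a set set" +
  fixes sel :: "'a list \<Rightarrow> 'a set \<Rightarrow> 'a"
  assumes S_connected: "S \<in> \<C>" and S_nonempty: "S \<noteq> {}"
    and sel_in: "D \<noteq> {} \<Longrightarrow> sel xs D \<in> D"
begin

text \<open>The path selected when \<open>s\<close> is followed: each step selects in the component
  containing \<open>s\<close>. Once \<open>s\<close> itself is selected, that component is empty and
  the further entries are arbitrary.\<close>

primrec walk :: "'a \<Rightarrow> nat \<Rightarrow> 'a list" where
  "walk s 0 = []"
| "walk s (Suc n) = walk s n @ [sel (walk s n) (component \<C> (set (walk s n)) s)]"

definition pick :: "'a \<Rightarrow> nat \<Rightarrow> 'a" where
  "pick s n = sel (walk s n) (component \<C> (set (walk s n)) s)"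

lemma walk_conv_map: "walk s n = map (pick s) [0..<n]"
  by (induction n) (simp_all add: pick_def)

declare walk.simps(2) [simp del]

lemma walk_Suc: "walk s (Suc n) = walk s n @ [pick s n]"
  by (simp add: walk_conv_map)

lemma set_walk: "set (walk s n) = pick s ` {..<n}"
  by (simp add: walk_conv_map atLeast0LessThan)

lemma walk_prefix_cong:
  assumes "walk s n = walk t n" "m \<le> n"
  shows "walk s m = walk t m"
proof -
  have "take m (walk u n) = walk u m" for u
    using assms(2) by (simp add: walk_conv_map take_map)
  then show ?thesis using assms(1) by metis
qed

lemma pick_in_component:
  assumes "s \<in> S" "s \<notin> set (walk s n)"
  shows "pick s n \<in> component \<C> (set (walk s n)) s"
  unfolding pick_def using component_self[OF assms] by (intro sel_in) auto

lemma component_empty: "s \<in> S \<Longrightarrow> component \<C> {} s = S"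
  using component_subset S_connected by (auto simp: component_def)

text \<open>A step depends on \<open>s\<close> only through its component, and sharing the component
  of \<open>s\<close> at step \<open>n\<close> implies sharing the larger ones at all earlier
  steps.\<close>

lemma walk_agree:
  assumes "t \<in> component \<C> (set (walk s n)) s"
  shows "walk t (Suc n) = walk s (Suc n)"
  using assms
proof (induction n)
  case 0
  then show ?case using component_eq[OF 0] by (simp add: walk.simps(2))
next
  case (Suc n)
  have "component \<C> (set (walk s (Suc n))) s \<subseteq> component \<C> (set (walk s n)) s"
    by (rule component_antimono) (auto simp: walk_Suc)
  then have eq: "walk t (Suc n) = walk s (Suc n)" using Suc by blast
  show ?case
    unfolding walk.simps(2)[of _ "Suc n"] eq using component_eq[OF Suc.prems] by simp
qed

section \<open>Vertices and root paths of the selection tree\<close>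

definition verts :: "'a set" where
  "verts = {v \<in> S. \<exists>n. v \<in> set (walk v n)}"

text \<open>The \<open>Suc\<close> gives the root depth 0 and makes
  \<open>pick v (depth v) = v\<close>. The value is meaningful only on \<open>verts\<close>.\<close>

definition depth :: "'a \<Rightarrow> nat" where
  "depth v = (LEAST n. v \<in> set (walk v (Suc n)))"

definition path :: "'a \<Rightarrow> 'a list" where
  "path v = walk v (Suc (depth v))"

definition root :: 'a where
  "root = sel [] S"

lemma not_in_walk_depth:
  assumes "i \<le> depth v" shows "v \<notin> set (walk v i)"
proof
  assume v: "v \<in> set (walk v i)"
  then obtain j where j: "i = Suc j" by (cases i) auto
  then have "depth v \<le> j" using v unfolding depth_def by (intro Least_le) simp
  then show False using assms j by simp
qed

lemma pick_depth:
  assumes "v \<in> verts" shows "pick v (depth v) = v"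
proof -
  obtain n where n: "v \<in> set (walk v n)" using assms by (auto simp: verts_def)
  then obtain m where "n = Suc m" by (cases n) auto
  then have "v \<in> set (walk v (Suc (depth v)))" using n LeastI[of "\<lambda>n. v \<in> set (walk v (Suc n))" m] by (simp add: depth_def)
  then show ?thesis using not_in_walk_depth[of "depth v" v] by (auto simp: walk_Suc)
qed

text \<open>The selected vertex lies in the component of \<open>s\<close>, so its own walk agrees
  with that of \<open>s\<close>; it is new because this component avoids the walk so far.\<close>

lemma pick_vertex:
  assumes "s \<in> S" "s \<notin> set (walk s n)"
  shows "pick s n \<in> verts" "path (pick s n) = walk s (Suc n)"
proof -
  let ?t = "pick s n"
  have t: "?t \<in> component \<C> (set (walk s n)) s" using pick_in_component[OF assms] .
  then have eq: "walk ?t (Suc n) = walk s (Suc n)" by (rule walk_agree)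
  have "?t \<notin> set (walk s n)" using t component_disjoint by blast
  then have notin: "?t \<notin> set (walk ?t n)" using walk_prefix_cong[OF eq, of n] by simp
  have mem: "?t \<in> set (walk ?t (Suc n))" unfolding eq by (simp add: walk_Suc)
  then show "?t \<in> verts" using t component_subset by (auto simp: verts_def)
  have "depth ?t = n"
    unfolding depth_def
  proof (rule Least_equality)
    fix m assume "?t \<in> set (walk ?t (Suc m))"
    moreover have "set (walk ?t (Suc m)) \<subseteq> set (walk ?t n)" if "m < n"
      using that by (auto simp: set_walk)
    ultimately show "n \<le> m" using notin by (meson not_le subsetD)
  qed (rule mem)
  then show "path ?t = walk s (Suc n)" using eq by (simp only: path_def)
qed

lemma length_path [simp]: "length (path v) = Suc (depth v)"
  by (simp add: path_def walk_conv_map)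

lemma nth_path: "i \<le> depth v \<Longrightarrow> path v ! i = pick v i"
  by (simp add: path_def walk_conv_map del: upt_Suc)

lemma verts_subset: "verts \<subseteq> S"
  by (auto simp: verts_def)

lemma pick_0: "s \<in> S \<Longrightarrow> pick s 0 = root"
  by (simp add: pick_def root_def component_empty)

sublocale path_system verts path root
proof
  obtain s where s: "s \<in> S" using S_nonempty by auto
  show "root \<in> verts" "path root = [root]"
    using pick_vertex[OF s, of 0] pick_0[OF s] by (auto simp: walk_conv_map)
next
  fix v assume v: "v \<in> verts"
  then have vS: "v \<in> S" using verts_subset by auto
  have "hd (path v) = path v ! 0" by (rule hd_conv_nth) (simp flip: length_greater_0_conv)
  then show "hd (path v) = root" using nth_path[of 0 v] pick_0[OF vS] by simp
  have "last (path v) = v" using pick_depth[OF v] by (simp add: path_def walk_Suc)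
  then show "path v \<noteq> [] \<and> last (path v) = v" by (simp flip: length_greater_0_conv)
  fix i assume "i < length (path v)"
  then have i: "i \<le> depth v" by simp
  then have "take (Suc i) (path v) = walk v (Suc i)"
    by (simp add: path_def walk_conv_map take_map del: upt_Suc)
  then show "path v ! i \<in> verts \<and> path (path v ! i) = take (Suc i) (path v)"
    using pick_vertex[OF vS not_in_walk_depth[OF i]] nth_path[OF i] by simp
qed

text \<open>Where the walks of \<open>u\<close> and \<open>v\<close> first part, the two lie in
  different components outside the common part of the walks. So \<open>C\<close> meets this common
  part, and every vertex there is below both.\<close>

lemma separates_incomparable_tree: "separates_incomparable \<C> tree"
  unfolding separates_incomparable_def
proof (intro ballI impI)
  fix C u v
  assume C: "C \<in> \<C>" and "u \<in> C \<inter> gverts tree" "v \<in> C \<inter> gverts tree"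
    and inc: "tree_incomparable tree u v"
  then have u: "u \<in> C" "u \<in> verts" and v: "v \<in> C" "v \<in> verts" by auto
  let ?m = "min (depth u) (depth v)"
  \<comment> \<open>If the walks agreed this far, the one of \<open>u\<close> and \<open>v\<close>
    with smaller depth would lie on the root path of the other.\<close>
  have "walk u (Suc ?m) \<noteq> walk v (Suc ?m)"
  proof
    assume eq: "walk u (Suc ?m) = walk v (Suc ?m)"
    show False
    proof (cases "depth u \<le> depth v")
      case True
      then have "walk v (Suc (depth u)) = walk u (Suc (depth u))" using eq by (simp add: min_def)
      then have "u \<in> set (walk v (Suc (depth u)))"
        using pick_depth[OF u(2)] walk_Suc[of u "depth u"] by (metis in_set_conv_decomp)
      also have "\<dots> \<subseteq> set (path v)" using True by (auto simp: path_def set_walk)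
      finally show False using inc v by (auto simp: tree_incomparable_def tree_le_iff)
    next
      case False
      then have "walk u (Suc (depth v)) = walk v (Suc (depth v))" using eq by (simp add: min_def)
      then have "v \<in> set (walk u (Suc (depth v)))"
        using pick_depth[OF v(2)] walk_Suc[of v "depth v"] by (metis in_set_conv_decomp)
      also have "\<dots> \<subseteq> set (path u)" using False by (auto simp: path_def set_walk)
      finally show False using inc u by (auto simp: tree_incomparable_def tree_le_iff)
    qed
  qed
  then have ex: "\<exists>n. walk u (Suc n) \<noteq> walk v (Suc n)" by blast
  define n where "n = (LEAST n. walk u (Suc n) \<noteq> walk v (Suc n))"
  have n: "walk u (Suc n) \<noteq> walk v (Suc n)" using LeastI_ex[OF ex] unfolding n_def .
  have "n \<le> ?m" unfolding n_def by (rule Least_le) fact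
  have eq: "walk u n = walk v n"
  proof (cases n)
    case (Suc k)
    then show ?thesis using not_less_Least[of k "\<lambda>n. walk u (Suc n) \<noteq> walk v (Suc n)"]
      unfolding n_def by auto
  qed simp
  have "C \<inter> set (walk u n) \<noteq> {}"
  proof
    assume "C \<inter> set (walk u n) = {}"
    then have "v \<in> component \<C> (set (walk u n)) u" using C u v by (auto simp: component_def)
    then show False using walk_agree[of v u n] n by simp
  qed
  then obtain w where w: "w \<in> C" "w \<in> set (walk u n)" by auto
  have "set (walk u n) \<subseteq> set (path u)" "set (walk v n) \<subseteq> set (path v)"
    using \<open>n \<le> ?m\<close> by (auto simp: path_def set_walk)
  then show "\<exists>w\<in>C. tree_le tree w u \<and> tree_le tree w v"
    using w eq u v by (intro bexI[of _ w]) (auto simp: tree_le_iff)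
qed

theorem weak_normal_tree: "weak_normal_tree S \<C> tree"
  unfolding weak_normal_tree_def
proof (intro conjI allI impI)
  fix u v assume "tree_le tree u v"
  then have v: "v \<in> verts" and "u \<in> set (path v)" by (auto simp: tree_le_iff)
  then obtain i where "i < length (path v)" "path v ! i = u" by (auto simp: in_set_conv_nth)
  then have i: "i \<le> depth v" and u: "u = pick v i" using nth_path by auto
  have vS: "v \<in> S" using v verts_subset by auto
  \<comment> \<open>Only the vertices strictly below \<open>u\<close> are removed; \<open>u\<close>
    was selected in the component of \<open>v\<close> that remains.\<close>
  let ?C = "component \<C> (set (walk v i)) v"
  have "\<not> tree_less tree w u" if "w \<in> ?C" for w
  proof
    assume "tree_less tree w u"
    then have "w \<in> set (path u)" "w \<noteq> u" by (auto simp: tree_less_def tree_le_iff)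
    moreover have "path u = walk v i @ [u]"
      using pick_vertex(2)[OF vS not_in_walk_depth[OF i]] u by (simp add: walk_Suc)
    ultimately show False using that component_disjoint[of "set (walk v i)" v] by auto
  qed
  moreover have "u \<in> ?C" "v \<in> ?C"
    using pick_in_component component_self vS not_in_walk_depth[OF i] u by auto
  ultimately show "\<exists>C\<in>\<C>. u \<in> C \<and> v \<in> C \<and> (\<forall>w\<in>C. \<not> tree_less tree w u)"
    using component_connected by blast
qed (use rooted_tree verts_subset separates_incomparable_tree in auto)

text \<open>Common form of a ray of the tree and of the endless walk towards an element that is
  never selected, so that one analysis serves both normality and exhaustion.\<close>

definition branch :: "(nat \<Rightarrow> 'a) \<Rightarrow> bool" where
  "branch t \<longleftrightarrow> (\<forall>i. t i \<in> S \<and> t i = sel (map t [0..<i]) (component \<C> (t ` {..<i}) (t i)) \<and>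
    (\<forall>j\<ge>i. t j \<in> component \<C> (t ` {..<i}) (t i)))"

lemma branch_rooted_ray:
  assumes R: "rooted_ray tree R" shows "branch R"
  unfolding branch_def
proof (intro allI conjI impI)
  have V: "R n \<in> verts" and p: "path (R n) = map R [0..<Suc n]" for n
    using path_rooted_ray[OF R] by auto
  have d: "depth (R n) = n" for n using arg_cong[OF p[of n], of length] by simp
  have pick: "pick (R j) i = R i" if "i \<le> j" for i j
    using nth_path[of i "R j"] p[of j] that by (simp add: d del: upt_Suc)
  then have walk: "walk (R j) i = map R [0..<i]" if "i \<le> j" for i j
    using that by (auto simp: walk_conv_map)
  have S: "R j \<in> S" for j using V verts_subset by auto
  then show "R i \<in> S" for i .
  have mem: "R i \<in> component \<C> (R ` {..<i}) (R j)" if "i \<le> j" for i j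
    using pick_in_component[OF S not_in_walk_depth, of i j] that
    by (simp add: d pick walk atLeast0LessThan)
  show "R j \<in> component \<C> (R ` {..<i}) (R i)" if "i \<le> j" for i j
  proof -
    have "R j \<in> component \<C> (R ` {..<i}) (R j)"
      using component_self[OF S not_in_walk_depth, of i j] that by (simp add: d walk atLeast0LessThan)
    then show ?thesis using component_eq[OF mem[OF that]] by simp
  qed
  show "R i = sel (map R [0..<i]) (component \<C> (R ` {..<i}) (R i))" for i
    using pick[of i i] walk[of i i] by (simp add: pick_def atLeast0LessThan)
qed

text \<open>The walk of \<open>s\<close> never reaches its arbitrary part, so every selection is
  made in the component of \<open>s\<close>.\<close>

lemma branch_unreached:
  assumes s: "s \<in> S" "s \<notin> verts"
  shows "branch (pick s)" "s \<in> component \<C> (pick s ` {..<i}) (pick s i)"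
proof -
  have notin: "s \<notin> set (walk s i)" for i using s by (auto simp: verts_def)
  have mem: "pick s i \<in> component \<C> (pick s ` {..<i}) s" for i
    using pick_in_component[OF s(1) notin] by (simp add: set_walk)
  then have eq: "component \<C> (pick s ` {..<i}) (pick s i) = component \<C> (pick s ` {..<i}) s" for i
    using component_eq by blast
  show "s \<in> component \<C> (pick s ` {..<i}) (pick s i)"
    using component_self[OF s(1) notin] by (simp add: eq set_walk)
  show "branch (pick s)"
    unfolding branch_def
  proof (intro allI conjI impI)
    show "pick s i \<in> S" for i using mem component_subset by blast
    show "pick s i = sel (map (pick s) [0..<i]) (component \<C> (pick s ` {..<i}) (pick s i))" for i
      unfolding eq by (simp add: pick_def[of s i] walk_conv_map atLeast0LessThan)
    show "pick s j \<in> component \<C> (pick s ` {..<i}) (pick s i)" if "i \<le> j" for i j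
    proof -
      have "component \<C> (pick s ` {..<j}) s \<subseteq> component \<C> (pick s ` {..<i}) s"
        using that by (intro component_antimono) auto
      then show ?thesis using mem[of j] eq by blast
    qed
  qed
qed

end

section \<open>Closure under countable-valued operators\<close>

definition closure_step :: "('a set \<Rightarrow> 'a set \<Rightarrow> 'a set) \<Rightarrow> 'a set \<Rightarrow> 'a set" where
  "closure_step q X = X \<union> (\<Union>A\<in>{A. finite A \<and> A \<subseteq> X}. \<Union>B\<in>{B. finite B \<and> B \<subseteq> X}. q A B)"

text \<open>As \<open>q\<close> is applied to finite subsets only, \<omega> iterations give a closed
  set: any two finite subsets already lie in one stage.\<close>

definition closure_under :: "('a set \<Rightarrow> 'a set \<Rightarrow> 'a set) \<Rightarrow> 'a set \<Rightarrow> 'a set" where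
  "closure_under q X = (\<Union>n. (closure_step q ^^ n) X)"

lemma finite_subset_incseq_UN:
  assumes "finite A" "A \<subseteq> (\<Union>n. G n)" and mono: "\<And>m n. m \<le> n \<Longrightarrow> G m \<subseteq> G (n::nat)"
  obtains n where "\<And>m. n \<le> m \<Longrightarrow> A \<subseteq> G m"
proof -
  have "\<exists>k. \<forall>j\<ge>k. x \<in> G j" if x: "x \<in> A" for x
  proof -
    obtain k where "x \<in> G k" using assms(2) x by blast
    then show ?thesis using mono by blast
  qed
  then obtain k where "\<And>x j. x \<in> A \<Longrightarrow> j \<ge> k \<Longrightarrow> x \<in> G j"
    using finite_uniform_bound[OF assms(1), of "\<lambda>x j. x \<in> G j"] by blast
  then show thesis using that by blast
qed

lemma closure_step_mono: "X \<subseteq> Y \<Longrightarrow> closure_step q X \<subseteq> closure_step q Y"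
  unfolding closure_step_def by blast

lemma closure_under_mono:
  assumes "X \<subseteq> Y" shows "closure_under q X \<subseteq> closure_under q Y"
proof -
  have "(closure_step q ^^ n) X \<subseteq> (closure_step q ^^ n) Y" for n
    by (induction n) (simp_all add: assms closure_step_mono)
  then show ?thesis unfolding closure_under_def by blast
qed

lemma closure_under_superset: "X \<subseteq> closure_under q X"
  unfolding closure_under_def using UN_upper[of 0 UNIV "\<lambda>n. (closure_step q ^^ n) X"] by simp

lemma closure_under_closed:
  assumes "finite A" "A \<subseteq> closure_under q X" "finite B" "B \<subseteq> closure_under q X"
  shows "q A B \<subseteq> closure_under q X"
proof -
  let ?G = "\<lambda>n. (closure_step q ^^ n) X"
  have "?G n \<subseteq> ?G (Suc n)" for n by (simp add: closure_step_def)
  then have mono: "?G m \<subseteq> ?G n" if "m \<le> n" for m n using that by (rule lift_Suc_mono_le)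
  obtain k where k: "\<And>m. k \<le> m \<Longrightarrow> A \<union> B \<subseteq> ?G m"
    using finite_subset_incseq_UN[of "A \<union> B" ?G] mono assms unfolding closure_under_def
    by (metis Un_least finite_UnI)
  have "q A B \<subseteq> ?G (Suc k)"
    using k[of k] assms(1,3) by (simp add: closure_step_def) blast
  then show ?thesis unfolding closure_under_def by blast
qed

lemma countable_closure_under:
  assumes "\<And>A B. countable (q A B)" "countable X"
  shows "countable (closure_under q X)"
proof -
  have "countable (closure_step q Y)" if "countable Y" for Y
    unfolding closure_step_def
    using that assms(1) countable_Collect_finite_subset[OF that] by auto
  then have "countable ((closure_step q ^^ n) X)" for n
    by (induction n) (simp_all add: assms(2))
  then show ?thesis unfolding closure_under_def by simp
qed


section \<open>Normal trees from exhaustive selections\<close>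

definition uncountably_linked :: "'a set set \<Rightarrow> 'a set \<Rightarrow> 'a set \<Rightarrow> bool" where
  "uncountably_linked \<C> X Y \<longleftrightarrow> (\<exists>\<L>. uncountable \<L> \<and> (\<forall>L\<in>\<L>. XY_link \<C> X Y L) \<and>
     (\<forall>L\<in>\<L>. \<forall>L'\<in>\<L>. L \<noteq> L' \<longrightarrow> L \<inter> L' \<subseteq> X \<union> Y))"

text \<open>If the pair is not uncountably linked, a maximal family \<open>M\<close> of internally
  disjoint links is countable. Its union serves as \<open>Q\<close>, since by maximality no link
  meets it only inside \<open>X \<union> Y\<close>.\<close>

lemma countable_link_separator:
  "\<exists>Q. countable Q \<and> (\<forall>L. XY_link \<C> X Y L \<and> L \<inter> Q \<subseteq> X \<union> Y \<longrightarrow> uncountably_linked \<C> X Y)"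
proof (cases "uncountably_linked \<C> X Y")
  case True
  then show ?thesis by (intro exI[of _ "{}"]) simp
next
  case False
  define F where "F = {\<L>. (\<forall>L\<in>\<L>. XY_link \<C> X Y L) \<and> (\<forall>L\<in>\<L>. \<forall>L'\<in>\<L>. L \<noteq> L' \<longrightarrow> L \<inter> L' \<subseteq> X \<union> Y)}"
  have "\<exists>M\<in>F. \<forall>\<L>\<in>F. M \<subseteq> \<L> \<longrightarrow> \<L> = M"
  proof (rule subset_Zorn_nonempty)
    show "F \<noteq> {}" unfolding F_def by blast
  next
    fix \<K> assume "\<K> \<noteq> {}" and chain: "subset.chain F \<K>"
    then have sub: "\<K> \<subseteq> F" and lin: "\<And>a b. a \<in> \<K> \<Longrightarrow> b \<in> \<K> \<Longrightarrow> a \<subseteq> b \<or> b \<subseteq> a"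
      by (auto simp: subset.chain_def)
    have "L \<inter> L' \<subseteq> X \<union> Y" if LL: "L \<in> \<Union>\<K>" "L' \<in> \<Union>\<K>" "L \<noteq> L'" for L L'
    proof -
      obtain a b where "a \<in> \<K>" "L \<in> a" "b \<in> \<K>" "L' \<in> b" using LL by blast
      then obtain c where "c \<in> \<K>" "L \<in> c" "L' \<in> c" using lin[of a b] by blast
      then show ?thesis using sub LL(3) unfolding F_def by blast
    qed
    moreover have "XY_link \<C> X Y L" if "L \<in> \<Union>\<K>" for L
      using sub that unfolding F_def by blast
    ultimately show "\<Union>\<K> \<in> F" unfolding F_def by blast
  qed
  then obtain M where M: "M \<in> F" and max: "\<And>\<L>. \<L> \<in> F \<Longrightarrow> M \<subseteq> \<L> \<Longrightarrow> \<L> = M" by blast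
  have "countable M"
  proof (rule ccontr)
    assume "uncountable M"
    then have "uncountably_linked \<C> X Y"
      unfolding uncountably_linked_def using M by (intro exI[of _ M]) (simp add: F_def)
    then show False using False by simp
  qed
  moreover have "finite L" if "L \<in> M" for L using M that by (simp add: F_def XY_link_def)
  ultimately have "countable (\<Union>L\<in>M. L)" by (intro countable_UN) (simp_all add: countable_finite)
  then have "countable (\<Union>M)" by simp
  moreover have False if L: "XY_link \<C> X Y L" "L \<inter> \<Union>M \<subseteq> X \<union> Y" for L
  proof -
    have *: "L \<inter> L' \<subseteq> X \<union> Y" "L' \<inter> L \<subseteq> X \<union> Y" if "L' \<in> M" for L'
      using L(2) that by auto
    have "insert L M \<in> F" using M L(1) * by (simp add: F_def)
    \<comment> \<open>A link already in \<open>M\<close> would lie inside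
      \<open>X \<union> Y\<close>, but a common point of its two sides is in neither
      \<open>X\<close> nor \<open>Y\<close>.\<close>
    then have "L \<in> M" using max by blast
    then have "L \<subseteq> X \<union> Y" using L(2) by blast
    then show False using L(1) by (auto simp: XY_link_def)
  qed
  ultimately show ?thesis by (intro exI[of _ "\<Union>M"]) blast
qed

definition witness :: "'a set set \<Rightarrow> 'a set \<Rightarrow> 'a set \<Rightarrow> 'a set \<Rightarrow> 'a set \<Rightarrow> bool" where
  "witness \<C> A P W B \<longleftrightarrow> finite B \<and> B \<in> \<C> \<and> A \<subseteq> B \<and> B \<inter> P = {} \<and> B \<inter> W \<noteq> {}"

text \<open>Separators for links and witnesses for all \<open>W\<close> are merged into one operator
  of two sets, so that a single closure handles both; countability of \<open>\<W>\<close> keeps its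
  values countable.\<close>

lemma witness_operator:
  assumes "countable \<W>"
  obtains q where "\<And>A B. countable (q A B)"
    and "\<And>X Y L. XY_link \<C> X Y L \<Longrightarrow> L \<inter> q X Y \<subseteq> X \<union> Y \<Longrightarrow> uncountably_linked \<C> X Y"
    and "\<And>A P W B. W \<in> \<W> \<Longrightarrow> witness \<C> A P W B \<Longrightarrow> \<exists>B\<subseteq>q A P. witness \<C> A P W B"
proof -
  define s where "s X Y = (SOME Q. countable Q \<and>
    (\<forall>L. XY_link \<C> X Y L \<and> L \<inter> Q \<subseteq> X \<union> Y \<longrightarrow> uncountably_linked \<C> X Y))" for X Y
  have s: "countable (s X Y) \<and>
    (\<forall>L. XY_link \<C> X Y L \<and> L \<inter> s X Y \<subseteq> X \<union> Y \<longrightarrow> uncountably_linked \<C> X Y)" for X Y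
    unfolding s_def by (rule someI_ex) (rule countable_link_separator)
  \<comment> \<open>The default \<open>{}\<close> keeps \<open>w A P W\<close> finite even if there
    is no witness.\<close>
  define w where "w A P W = (if Ex (witness \<C> A P W) then SOME B. witness \<C> A P W B else {})" for A P W
  have w: "witness \<C> A P W (w A P W)" if "witness \<C> A P W B" for A P W B
  proof -
    have "Ex (witness \<C> A P W)" using that by blast
    then show ?thesis unfolding w_def by (simp add: someI_ex)
  qed
  have "finite (w A P W)" for A P W
  proof (cases "Ex (witness \<C> A P W)")
    case True
    then show ?thesis using w unfolding witness_def by blast
  next
    case False
    show ?thesis unfolding w_def by (simp only: False if_False finite.emptyI)
  qed
  then have "countable (s A P \<union> (\<Union>W\<in>\<W>. w A P W))" for A P
    using s[of A P] assms by (simp add: countable_finite)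
  then show thesis
  proof (rule that[of "\<lambda>A P. s A P \<union> (\<Union>W\<in>\<W>. w A P W)"])
    fix X Y L assume L: "XY_link \<C> X Y L" "L \<inter> (s X Y \<union> (\<Union>W\<in>\<W>. w X Y W)) \<subseteq> X \<union> Y"
    have "L \<inter> s X Y \<subseteq> X \<union> Y" using L(2) by blast
    then show "uncountably_linked \<C> X Y" using s[of X Y] L(1) by blast
  next
    fix A P W B assume "W \<in> \<W>" "witness \<C> A P W B"
    then show "\<exists>B\<subseteq>s A P \<union> (\<Union>W\<in>\<W>. w A P W). witness \<C> A P W B"
      using w by (intro exI[of _ "w A P W"]) auto
  qed
qed

text \<open>At time \<open>n = prod_encode (m, k)\<close> the selection tries the \<open>k\<close>-th element of the closure of
  the first \<open>m\<close> vertices, so that no element of the closure of an infinite branch stays available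
  forever.\<close>

locale exhaustive_selection = connectoid_space S \<C> for S :: "'a set" and \<C> :: "'a set set" +
  fixes q :: "'a set \<Rightarrow> 'a set \<Rightarrow> 'a set" and r :: 'a and \<W> :: "'a set set"
  assumes space_connected: "S \<in> \<C>" and r_in: "r \<in> S"
    and countable_q: "countable (q A B)"
    and q_link: "XY_link \<C> A B L \<Longrightarrow> L \<inter> q A B \<subseteq> A \<union> B \<Longrightarrow> uncountably_linked \<C> A B"
    and q_witness: "W \<in> insert S \<W> \<Longrightarrow> witness \<C> A B W D \<Longrightarrow> \<exists>B'\<subseteq>q A B. witness \<C> A B W B'"
begin

text \<open>The empty history requests \<open>r\<close>, which makes \<open>r\<close> the root. A
  requested element need not lie in the available component.\<close>

definition request :: "'a list \<Rightarrow> 'a" where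
  "request xs = (if xs = [] then r else case prod_decode (length xs) of
     (m, k) \<Rightarrow> from_nat_into (closure_under q (set (take m xs))) k)"

definition selector :: "'a list \<Rightarrow> 'a set \<Rightarrow> 'a" where
  "selector xs D = (if request xs \<in> D then request xs else SOME y. y \<in> D)"

sublocale selection S \<C> selector
proof
  show "selector xs D \<in> D" if "D \<noteq> {}" for xs D
    using that by (auto simp: selector_def intro: someI)
qed (use space_connected r_in in auto)

lemma root_eq: "root = r"
  using r_in by (simp add: root_def selector_def request_def)

section \<open>Components and closure along a branch\<close>

context
  fixes t :: "nat \<Rightarrow> 'a"
  assumes t: "branch t"
begin

definition tail_component :: "nat \<Rightarrow> 'a set" where
  "tail_component i = component \<C> (t ` {..<i}) (t i)"

text \<open>Built from initial segments because a request sees only the vertices selected so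
  far.\<close>

definition branch_closure :: "'a set" where
  "branch_closure = (\<Union>m. closure_under q (t ` {..<m}))"

lemma branch_facts: "t i \<in> S" "t i = selector (map t [0..<i]) (tail_component i)" "i \<le> j \<Longrightarrow> t j \<in> tail_component i"
  using t by (auto simp: branch_def tail_component_def)

lemma tail_component_antimono:
  assumes "i \<le> j" shows "tail_component j \<subseteq> tail_component i"
proof -
  have "tail_component j \<subseteq> component \<C> (t ` {..<i}) (t j)"
    unfolding tail_component_def using assms by (intro component_antimono) auto
  also have "\<dots> = tail_component i" using component_eq branch_facts(3)[OF assms] unfolding tail_component_def by blast
  finally show ?thesis .
qed

lemma tail_component_connected: "tail_component i \<in> \<C>" and tail_component_disjoint: "tail_component i \<inter> t ` {..<i} = {}"
  using component_connected component_disjoint by (auto simp: tail_component_def)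

lemma closures_mono: "m \<le> n \<Longrightarrow> closure_under q (t ` {..<m}) \<subseteq> closure_under q (t ` {..<n})"
  by (intro closure_under_mono) auto

lemma branch_closure_exhausted:
  assumes "y \<in> branch_closure" shows "\<exists>k. \<forall>j\<ge>k. y \<notin> tail_component j"
proof -
  obtain m where "y \<in> closure_under q (t ` {..<m})" using assms by (auto simp: branch_closure_def)
  \<comment> \<open>With \<open>Suc m\<close> the time \<open>?n\<close> is positive, so the history
    is nonempty and the default request \<open>r\<close> does not apply.\<close>
  then have y: "y \<in> closure_under q (t ` {..<Suc m})" using closures_mono[of m "Suc m"] by auto
  have "countable (closure_under q (t ` {..<Suc m}))"
    using countable_q by (intro countable_closure_under) auto
  then obtain k where k: "from_nat_into (closure_under q (t ` {..<Suc m})) k = y"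
    using from_nat_into_surj y by metis
  let ?n = "prod_encode (Suc m, k)"
  have n: "Suc m \<le> ?n" by (rule le_prod_encode_1)
  have "set (take (Suc m) (map t [0..<?n])) = t ` {..<Suc m}"
    using n by (simp add: take_map atLeast0LessThan del: upt_Suc)
  then have "request (map t [0..<?n]) = y" using n k by (simp add: request_def del: upt_Suc)
  then have "t ?n = y" if "y \<in> tail_component ?n" using branch_facts(2)[of ?n] that by (simp add: selector_def)
  then have "y \<notin> tail_component ?n \<or> y \<notin> tail_component (Suc ?n)" using tail_component_disjoint[of "Suc ?n"] by auto
  then show ?thesis using tail_component_antimono by blast
qed

lemma finite_exhausted:
  assumes "finite Z" "Z \<subseteq> branch_closure" shows "\<exists>k. \<forall>j\<ge>k. Z \<inter> tail_component j = {}"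
proof -
  have "\<exists>k. \<forall>j\<ge>k. y \<notin> tail_component j" if "y \<in> Z" for y using branch_closure_exhausted assms(2) that by blast
  then obtain k where "\<And>y j. y \<in> Z \<Longrightarrow> k \<le> j \<Longrightarrow> y \<notin> tail_component j"
    using finite_uniform_bound[OF assms(1), of "\<lambda>y j. y \<notin> tail_component j"] by blast
  then show ?thesis by (intro exI[of _ k]) blast
qed

lemma branch_in_closure: "t i \<in> branch_closure"
  using closure_under_superset[of "t ` {..<Suc i}" q] by (auto simp: branch_closure_def)

lemma branch_closure_closed:
  assumes "finite A" "A \<subseteq> branch_closure" "finite B" "B \<subseteq> branch_closure" shows "q A B \<subseteq> branch_closure"
proof -
  have "A \<union> B \<subseteq> (\<Union>m. closure_under q (t ` {..<m}))" using assms by (auto simp: branch_closure_def)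
  moreover have "finite (A \<union> B)" using assms by simp
  ultimately obtain m where "A \<union> B \<subseteq> closure_under q (t ` {..<m})"
    using finite_subset_incseq_UN[of "A \<union> B" "\<lambda>m. closure_under q (t ` {..<m})"] closures_mono
    by (metis order_refl)
  then have "q A B \<subseteq> closure_under q (t ` {..<m})"
    using assms(1,3) by (intro closure_under_closed) auto
  then show ?thesis by (auto simp: branch_closure_def)
qed

text \<open>A witness exists inside the component, so \<open>q\<close> provides one inside the
  closure. That one is connected, avoids the earlier vertices and contains the nonempty set
  \<open>A\<close>, so it stays in the component.\<close>

lemma branch_witness:
  assumes W: "W \<in> insert S \<W>" "tail_component i \<inter> W \<noteq> {}" and A: "finite A" "A \<noteq> {}" "A \<subseteq> branch_closure" "A \<subseteq> tail_component i"
  shows "\<exists>B. finite B \<and> B \<in> \<C> \<and> A \<subseteq> B \<and> B \<subseteq> branch_closure \<and> B \<subseteq> tail_component i \<and> B \<inter> W \<noteq> {}"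
proof -
  obtain w where w: "w \<in> tail_component i" "w \<in> W" using W(2) by auto
  obtain G where G: "finite G" "G \<in> \<C>" "insert w A \<subseteq> G" "G \<subseteq> tail_component i"
    using A w by (rule_tac finite_connected_between[OF tail_component_connected, of "insert w A" i]) auto
  have "G \<inter> t ` {..<i} = {}" using tail_component_disjoint[of i] G(4) by blast
  moreover have "w \<in> G \<inter> W" using G(3) w(2) by simp
  ultimately have "witness \<C> A (t ` {..<i}) W G" using G by (auto simp: witness_def)
  then have "\<exists>B\<subseteq>q A (t ` {..<i}). witness \<C> A (t ` {..<i}) W B" by (rule q_witness[OF W(1)])
  then obtain B where B: "B \<subseteq> q A (t ` {..<i})" "witness \<C> A (t ` {..<i}) W B" by blast
  have "q A (t ` {..<i}) \<subseteq> branch_closure" using A branch_in_closure by (intro branch_closure_closed) auto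
  moreover have "B \<subseteq> tail_component i"
    unfolding tail_component_def
  proof (rule component_maximal)
    show "B \<inter> component \<C> (t ` {..<i}) (t i) \<noteq> {}"
      using A B(2) unfolding witness_def tail_component_def by blast
  qed (use B(2) in \<open>auto simp: witness_def\<close>)
  moreover have "finite B" "B \<in> \<C>" "A \<subseteq> B" "B \<inter> W \<noteq> {}" using B(2) by (simp_all add: witness_def)
  ultimately show ?thesis using B(1) by (intro exI[of _ B]) auto
qed

lemma branch_necklace: "\<exists>N. necklace \<C> N \<and> range t \<subseteq> N"
proof -
  \<comment> \<open>The bead \<open>H\<close> covers \<open>t i\<close> to \<open>t j\<close> inside
    \<open>tail_component i\<close>. The next bead starts at \<open>t j\<close>, so the two meet,
    and ends so late that all beads after it avoid \<open>H\<close>. The clause for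
    \<open>n = 0\<close> makes the beads cover the branch from its start.\<close>
  define P where "P = (\<lambda>n::nat. \<lambda>(i, j, H). (n = 0 \<longrightarrow> i = 0) \<and> i < j \<and> finite H \<and> H \<in> \<C> \<and>
    t ` {i..j} \<subseteq> H \<and> H \<subseteq> branch_closure \<and> H \<subseteq> tail_component i)"
  define Q where "Q = (\<lambda>n::nat. \<lambda>(i::nat, j::nat, H). \<lambda>(i', j', H'::'a set). i' = j \<and> H \<inter> tail_component j' = {})"
  have ex: "\<exists>H. P n (i, j, H)" if "i < j" "n = 0 \<longrightarrow> i = 0" for i j n
  proof -
    \<comment> \<open>With \<open>S\<close> in the role of \<open>W\<close>,
      \<open>branch_witness\<close> amounts to a finite connected extension inside the
      closure.\<close>
    have "tail_component i \<inter> S \<noteq> {}" using branch_facts(1,3)[of i] by blast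
    moreover have "t ` {i..j} \<subseteq> branch_closure" "t ` {i..j} \<subseteq> tail_component i" "t ` {i..j} \<noteq> {}"
      using branch_in_closure branch_facts(3) \<open>i < j\<close> by auto
    ultimately obtain B where "finite B" "B \<in> \<C>" "t ` {i..j} \<subseteq> B" "B \<subseteq> branch_closure" "B \<subseteq> tail_component i"
      using branch_witness[of S i "t ` {i..j}"] by auto
    then show ?thesis using that unfolding P_def by (intro exI[of _ B]) simp
  qed
  have "\<exists>f. \<forall>n. P n (f n) \<and> Q n (f n) (f (Suc n))"
  proof (rule dependent_nat_choice)
    show "\<exists>x. P 0 x" using ex[of 0 1 0] by auto
    fix x n assume "P n x"
    then obtain i j H where x: "x = (i, j, H)" and H: "finite H" "H \<subseteq> branch_closure" by (cases x) (auto simp: P_def)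
    obtain k where k: "\<forall>l\<ge>k. H \<inter> tail_component l = {}" using finite_exhausted[OF H] by blast
    obtain H' where "P (Suc n) (j, max k (Suc j), H')" using ex[of j "max k (Suc j)" "Suc n"] by (auto simp: less_max_iff_disj)
    moreover have "Q n x (j, max k (Suc j), H')" using k by (simp add: Q_def x)
    ultimately show "\<exists>y. P (Suc n) y \<and> Q n x y" by blast
  qed
  then obtain f where f: "\<And>n. P n (f n)" "\<And>n. Q n (f n) (f (Suc n))" by blast
  define a b H where "a n = fst (f n)" and "b n = fst (snd (f n))" and "H n = snd (snd (f n))" for n
  have fn: "f n = (a n, b n, H n)" for n by (simp add: a_def b_def H_def)
  have P: "a n < b n" "finite (H n)" "H n \<in> \<C>" "t ` {a n..b n} \<subseteq> H n" "H n \<subseteq> tail_component (a n)" for n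
    using f(1)[of n] by (auto simp: P_def fn)
  have a0: "a 0 = 0" using f(1)[of 0] by (simp add: P_def fn)
  have Q: "a (Suc n) = b n" "H n \<inter> tail_component (b (Suc n)) = {}" for n
    using f(2)[of n] by (auto simp: Q_def fn)
  have amono: "strict_mono a" unfolding strict_mono_Suc_iff using P(1) Q(1) by simp
  have "necklace \<C> (\<Union>n. H n)"
  proof (rule necklace_UnionI)
    fix n
    have "t (b n) \<in> H n" using P(1)[of n] P(4)[of n] by auto
    moreover have "t (b n) \<in> H (Suc n)" using P(1)[of "Suc n"] P(4)[of "Suc n"] Q(1)[of n] by auto
    ultimately show "H n \<inter> H (Suc n) \<noteq> {}" by blast
  next
    fix i j :: nat assume "i + 2 \<le> j"
    then have "a (Suc (Suc i)) \<le> a j" using amono by (simp add: strict_mono_less_eq)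
    then have "H j \<subseteq> tail_component (a (Suc (Suc i)))" using P(5)[of j] tail_component_antimono by blast
    then show "H i \<inter> H j = {}" using Q(2)[of i] Q(1)[of "Suc i"] by auto
  qed (use P in auto)
  moreover have "t ` {..b n} \<subseteq> (\<Union>n. H n)" for n
  proof (induction n)
    case 0
    then show ?case using P(4)[of 0] a0 by (auto simp: atLeast0AtMost)
  next
    case (Suc n)
    have "{..b (Suc n)} \<subseteq> {..b n} \<union> {a (Suc n)..b (Suc n)}" using Q(1)[of n] by auto
    then show ?case using Suc P(4)[of "Suc n"] by blast
  qed
  moreover have "n \<le> b n" for n using strict_mono_imp_increasing[OF amono, of n] P(1)[of n] by simp
  ultimately show ?thesis by (intro exI[of _ "\<Union>n. H n"]) blast
qed

text \<open>The links from one branch set to another run through \<open>u\<close>, and their interiors avoid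
  \<open>branch_closure\<close>; so \<open>q_link\<close> applies to each pair of branch sets.\<close>

lemma not_fat_TK_dispersed:
  assumes u: "\<And>i. u \<in> tail_component i" and uW: "u \<in> W" and W: "W \<in> \<W>"
  shows "\<not> fat_TK_dispersed S \<C> W"
proof
  assume disp: "fat_TK_dispersed S \<C> W"
  \<comment> \<open>In a state \<open>(B, F, Z)\<close>, \<open>B\<close> is a new branch set,
    \<open>F\<close> joins it to \<open>u\<close> and meets the closure only inside
    \<open>B\<close>, and \<open>Z\<close> collects the earlier branch sets.\<close>
  define P where "P = (\<lambda>n::nat. \<lambda>(B, F, Z). finite B \<and> B \<in> \<C> \<and> B \<subseteq> branch_closure \<and> B \<inter> W \<noteq> {} \<and> B \<inter> Z = {} \<and>
    finite F \<and> F \<in> \<C> \<and> u \<in> F \<and> F \<inter> branch_closure \<subseteq> B \<and> F \<inter> B \<noteq> {} \<and> finite Z \<and> Z \<subseteq> branch_closure)"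
  define Q where "Q = (\<lambda>n::nat. \<lambda>(B, F::'a set, Z). \<lambda>(B'::'a set, F'::'a set, Z'). Z' = Z \<union> (B::'a set))"
  have ex: "\<exists>B F. P n (B, F, Z)" if Z: "finite Z" "Z \<subseteq> branch_closure" for n Z
  proof -
    \<comment> \<open>A branch set found in \<open>tail_component i\<close> is then disjoint from
      the earlier ones.\<close>
    obtain i where "\<forall>j\<ge>i. Z \<inter> tail_component j = {}" using finite_exhausted[OF Z] by blast
    then have i: "Z \<inter> tail_component i = {}" by simp
    obtain F where F: "finite F" "F \<in> \<C>" "{u, t i} \<subseteq> F" "F \<subseteq> tail_component i"
      using u branch_facts(3)[of i i]
      by (rule_tac finite_connected_between[OF tail_component_connected, of "{u, t i}" i]) auto
    have KW: "tail_component i \<inter> W \<noteq> {}" using u[of i] uW by blast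
    have ti: "t i \<in> F \<inter> branch_closure" using F(3) branch_in_closure by blast
    have FY: "finite (F \<inter> branch_closure)" "F \<inter> branch_closure \<noteq> {}" "F \<inter> branch_closure \<subseteq> branch_closure" "F \<inter> branch_closure \<subseteq> tail_component i" using ti F(1,4) by auto
    \<comment> \<open>\<open>B\<close> contains all of \<open>F \<inter> branch_closure\<close>, so
      the rest of \<open>F\<close> lies outside the closure; \<open>t i\<close> was put into
      \<open>F\<close> to make this intersection nonempty.\<close>
    obtain B where B: "finite B" "B \<in> \<C>" "F \<inter> branch_closure \<subseteq> B" "B \<subseteq> branch_closure" "B \<subseteq> tail_component i" "B \<inter> W \<noteq> {}"
      using branch_witness[OF insertI2[OF W] KW FY] by blast
    have "B \<inter> Z = {}" "F \<inter> B \<noteq> {}" using B(3,5) i ti by auto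
    then have "P n (B, F, Z)" using F B Z unfolding P_def by simp
    then show ?thesis by blast
  qed
  have "\<exists>f. \<forall>n. P n (f n) \<and> Q n (f n) (f (Suc n))"
  proof (rule dependent_nat_choice)
    show "\<exists>x. P 0 x" using ex[of "{}" 0] by auto
    fix x n assume Px: "P n x"
    obtain B F Z where x: "x = (B, F, Z)" by (cases x)
    have "finite (Z \<union> B)" "Z \<union> B \<subseteq> branch_closure" using Px by (auto simp: P_def x)
    then obtain B' F' where "P (Suc n) (B', F', Z \<union> B)" using ex by blast
    moreover have "Q n x (B', F', Z \<union> B)" by (simp add: Q_def x)
    ultimately show "\<exists>y. P (Suc n) y \<and> Q n x y" by blast
  qed
  then obtain f where f: "\<And>n. P n (f n)" "\<And>n. Q n (f n) (f (Suc n))" by blast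
  define B F Z where "B n = fst (f n)" and "F n = fst (snd (f n))" and "Z n = snd (snd (f n))" for n
  have fn: "f n = (B n, F n, Z n)" for n by (simp add: B_def F_def Z_def)
  have P: "finite (B n)" "B n \<in> \<C>" "B n \<subseteq> branch_closure" "B n \<inter> W \<noteq> {}" "B n \<inter> Z n = {}"
    "finite (F n)" "F n \<in> \<C>" "u \<in> F n" "F n \<inter> branch_closure \<subseteq> B n" "F n \<inter> B n \<noteq> {}" for n
    using f(1)[of n] by (simp_all add: P_def fn)
  have Q: "Z (Suc n) = Z n \<union> B n" for n using f(2)[of n] by (simp add: Q_def fn)
  have BZ: "B i \<subseteq> Z j" if "i < j" for i j
    using that by (induction j) (auto simp: Q less_Suc_eq)
  have disj: "B i \<inter> B j = {}" if "i \<noteq> j" for i j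
  proof (cases "i < j")
    case True
    then show ?thesis using BZ[of i j] P(5)[of j] by blast
  next
    case False
    then show ?thesis using BZ[of j i] P(5)[of i] that by auto
  qed
  have linked: "uncountably_linked \<C> (B n) (B m)" if "n \<noteq> m" for n m
  proof (rule q_link)
    \<comment> \<open>The sets \<open>B i \<union> F i\<close> for the two indices are the sides of
      the link. They share \<open>u\<close>, and neither branch set meets the opposite side, because
      branch sets are disjoint and lie in the closure.\<close>
    let ?L = "(B n \<union> F n) \<union> (B m \<union> F m)"
    have C: "B i \<union> F i \<in> \<C>" for i
      using P(2,7,10)[of i] by (intro Un_connected) (auto simp: Int_commute)
    have u_in: "u \<in> (B n \<union> F n) \<inter> (B m \<union> F m)" using P(8)[of n] P(8)[of m] by blast
    have "?L \<in> \<C>" using u_in by (intro Un_connected[OF C C]) blast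
    moreover have "B n \<subseteq> (B n \<union> F n) - (B m \<union> F m)"
      using P(3)[of n] P(9)[of m] disj[OF that] by blast
    moreover have "B m \<subseteq> (B m \<union> F m) - (B n \<union> F n)"
      using P(3)[of m] P(9)[of n] disj[OF that] by blast
    moreover have "(B n \<union> F n) \<inter> (B m \<union> F m) \<noteq> {}" using u_in by blast
    moreover have "finite ?L" using P(1,6) by simp
    ultimately show "XY_link \<C> (B n) (B m) ?L"
      unfolding XY_link_def using C[of n] C[of m]
      by (intro conjI bexI[of _ "B n \<union> F n"] bexI[of _ "B m \<union> F m"]) simp_all
    have "q (B n) (B m) \<subseteq> branch_closure" using P(1,3) by (intro branch_closure_closed) auto
    then show "?L \<inter> q (B n) (B m) \<subseteq> B n \<union> B m" using P(9)[of n] P(9)[of m] by blast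
  qed
  define \<L> where "\<L> n m = (SOME \<L>. uncountable \<L> \<and> (\<forall>L\<in>\<L>. XY_link \<C> (B n) (B m) L) \<and>
     (\<forall>L\<in>\<L>. \<forall>L'\<in>\<L>. L \<noteq> L' \<longrightarrow> L \<inter> L' \<subseteq> B n \<union> B m))" for n m
  have "uncountable (\<L> n m) \<and> (\<forall>L\<in>\<L> n m. XY_link \<C> (B n) (B m) L) \<and>
     (\<forall>L\<in>\<L> n m. \<forall>L'\<in>\<L> n m. L \<noteq> L' \<longrightarrow> L \<inter> L' \<subseteq> B n \<union> B m)" if "n \<noteq> m" for n m
    unfolding \<L>_def by (rule someI_ex) (use linked[OF that] in \<open>simp only: uncountably_linked_def\<close>)
  then have "fat_TK \<C> B \<L>" unfolding fat_TK_def using P(1,2) disj by simp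
  then have "finite {n. B n \<inter> W \<noteq> {}}" using disp unfolding fat_TK_dispersed_def by blast
  then show False using P(4) by simp
qed

end

section \<open>The tree of the exhaustive selection\<close>

lemma normal_tree_tree: "normal_tree S \<C> tree"
  unfolding normal_tree_def
proof (intro conjI allI impI)
  fix R assume "rooted_ray tree R"
  then obtain N where "necklace \<C> N" "range R \<subseteq> N"
    using branch_necklace[OF branch_rooted_ray] by blast
  then have "necklace \<C> N \<and> finite (range R - N)" by (simp add: Diff_eq_empty_iff[THEN iffD2])
  then show "\<exists>N. necklace \<C> N \<and> finite (range R - N)" by blast
qed (rule weak_normal_tree)

text \<open>If \<open>u\<close> were never selected, it would stay in every component along the
  branch of its own picks, and \<open>W\<close> would not be dispersed.\<close>

lemma dispersed_reached:
  assumes "W \<in> \<W>" "fat_TK_dispersed S \<C> W"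
  shows "W \<subseteq> gverts tree"
  unfolding tree_simps
proof
  fix u assume u: "u \<in> W"
  then have uS: "u \<in> S" using assms(2) by (auto simp: fat_TK_dispersed_def)
  show "u \<in> verts"
  proof (rule ccontr)
    assume nv: "u \<notin> verts"
    have "u \<in> tail_component (pick u) i" for i
      using branch_unreached(2)[OF uS nv] by (simp add: tail_component_def[OF branch_unreached(1)[OF uS nv]])
    then show False
      using not_fat_TK_dispersed[OF branch_unreached(1)[OF uS nv] _ u assms(1)] assms(2) by blast
  qed
qed

lemma groot_tree: "groot tree = r"
  by (rule trans[OF tree_simps(2) root_eq])

end

section \<open>The cycle of implications\<close>

theorem theorem1p1:
  fixes S U :: "'a set" and \<C> :: "'a set set"
  assumes "connected_connectoid S \<C>"
    and "S \<noteq> {}"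
    and "U \<subseteq> S"
  defines "stmt1 \<equiv> \<forall>r\<in>S. \<exists>T. normal_tree S \<C> T \<and> groot T = r \<and> U \<subseteq> gverts T"
    and "stmt2 \<equiv> \<exists>T. weak_normal_tree S \<C> T \<and> U \<subseteq> gverts T"
    and "stmt3 \<equiv> \<exists>T. rooted_tree T \<and> U \<subseteq> gverts T \<and> gverts T \<subseteq> S \<and> separates_incomparable \<C> T"
    and "stmt4 \<equiv> countable_union_of (dispersed S \<C>) U"
    and "stmt5 \<equiv> countable_union_of (fat_TK_dispersed S \<C>) U"
  shows "(stmt1 \<longleftrightarrow> stmt2) \<and> (stmt2 \<longleftrightarrow> stmt3) \<and> (stmt3 \<longleftrightarrow> stmt4) \<and> (stmt4 \<longleftrightarrow> stmt5)"
proof -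
  interpret connectoid_space S \<C>
    by standard (use assms(1) in \<open>simp add: connected_connectoid_def\<close>)
  \<comment> \<open>Nonemptiness of \<open>S\<close> supplies a root.\<close>
  have "stmt1 \<Longrightarrow> stmt2"
    using \<open>S \<noteq> {}\<close> unfolding stmt1_def stmt2_def normal_tree_def by blast
  moreover have "stmt2 \<Longrightarrow> stmt3"
    unfolding stmt2_def stmt3_def weak_normal_tree_def by blast
  moreover have "stmt3 \<Longrightarrow> stmt4"
    unfolding stmt3_def stmt4_def using countable_union_of_dispersed by blast
  moreover have "stmt4 \<Longrightarrow> stmt5"
    unfolding stmt4_def stmt5_def countable_union_of_def
    using dispersed_imp_fat_TK_dispersed by blast
  moreover have "stmt1" if stmt5
  proof -
    obtain \<W> where W: "countable \<W>" "\<And>W. W \<in> \<W> \<Longrightarrow> fat_TK_dispersed S \<C> W" "U = \<Union>\<W>"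
      using \<open>stmt5\<close> unfolding stmt5_def countable_union_of_def by blast
    \<comment> \<open>\<open>S\<close> joins the family so that the same operator also serves the
      necklaces along the branches.\<close>
    have "countable (insert S \<W>)" using W(1) by simp
    then obtain q where q: "\<And>A B. countable (q A B)"
      "\<And>X Y L. XY_link \<C> X Y L \<Longrightarrow> L \<inter> q X Y \<subseteq> X \<union> Y \<Longrightarrow> uncountably_linked \<C> X Y"
      "\<And>A P W B. W \<in> insert S \<W> \<Longrightarrow> witness \<C> A P W B \<Longrightarrow> \<exists>B\<subseteq>q A P. witness \<C> A P W B"
      by (rule witness_operator) blast
    show stmt1
      unfolding stmt1_def
    proof
      fix r assume "r \<in> S"
      interpret T: exhaustive_selection S \<C> q r \<W>
        by standard (use \<open>r \<in> S\<close> assms(1) q in \<open>simp_all add: connected_connectoid_def\<close>)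
      have "U \<subseteq> gverts T.tree" using W T.dispersed_reached by blast
      then show "\<exists>T. normal_tree S \<C> T \<and> groot T = r \<and> U \<subseteq> gverts T"
        using T.normal_tree_tree T.groot_tree by blast
    qed
  qed
  ultimately show ?thesis by blast
qed

end
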